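(* Given a totally real cubic number field $F$ with ring of integers $\mathcal{O}_F$, there is a (fractional) $\mathcal{O}_F$-ideal $\mathcal{I}$ with an admissible $\mathbb{Z}$-basis.
   Context: Let $Q\colon F\to F$ be $Q(x)=N^F_{\mathbb Q}(x)/x$. A $\mathbb{Z}$-basis $(r_1,r_2,r_3)$ of a lattice $\mathcal{I}\subset F$ is admissible if it satisfies the no-half-space condition: $0$ lies in the interior of the convex hull of $\{Q(r_1),Q(r_2),Q(r_3)\}$, the interior being taken in the $\mathbb{R}$-span of $Q(r_1),Q(r_2),Q(r_3)$ in $F\otimes_{\mathbb Q}\mathbb{R}$. *)

theory Defs
  imports
    "HOL-Analysis.Analysis"
    "HOL-Computational_Algebra.Polynomial"
    "HOL-Library.Poly_Mapping"
    "Jordan_Normal_Form.Determinant"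
begin

section \<open>Number fields\<close>

interpretation rat_vs: vector_space "\<lambda>q x. of_rat q * (x :: 'a :: field_char_0)"
  by unfold_locales (simp_all add: algebra_simps of_rat_add of_rat_mult)

interpretation int_mod: Modules.module "\<lambda>(n :: int) x. of_int n * (x :: 'a :: comm_ring_1)"
  by unfold_locales (simp_all add: algebra_simps)

text \<open>
  The axiom says that the field is finite-dimensional over the rationals; it spells out the
  rational coefficients as fractions because \<^const>\<open>of_rat\<close> is not available inside a class
  specification (see \<open>ex_finite_rat_span\<close> below).
\<close>

class number_field = field_char_0 +
  assumes finite_over_rat:
    "\<exists>B. finite B \<and> (\<forall>x. \<exists>c d. x = (\<Sum>b\<in>B. of_int (c b) / of_nat (d b) * b))"

lemma ex_finite_rat_span:
  "\<exists>B :: 'a :: number_field set. finite B \<and> rat_vs.span B = UNIV"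
proof -
  obtain B :: "'a set" where B: "finite B"
    "\<And>x. \<exists>c d. x = (\<Sum>b\<in>B. of_int (c b) / of_nat (d b) * b)"
    using finite_over_rat by metis
  have "x \<in> rat_vs.span B" for x
  proof -
    obtain c d where x: "x = (\<Sum>b\<in>B. of_int (c b) / of_nat (d b) * b)" using B(2) by blast
    have "x = (\<Sum>b\<in>B. of_rat (of_int (c b) / of_nat (d b)) * b)"
      unfolding x by (simp add: of_rat_divide)
    also have "\<dots> \<in> rat_vs.span B"
      by (intro rat_vs.span_sum rat_vs.span_scale rat_vs.span_base)
    finally show ?thesis .
  qed
  with B(1) show ?thesis by blast
qed

definition rat_basis :: "'a :: number_field list" where
  "rat_basis = (SOME bs. distinct bs \<and> rat_vs.independent (set bs) \<and> rat_vs.span (set bs) = UNIV)"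

lemma
  distinct_rat_basis: "distinct (rat_basis :: 'a :: number_field list)" and
  independent_rat_basis: "rat_vs.independent (set (rat_basis :: 'a list))" and
  span_rat_basis: "rat_vs.span (set (rat_basis :: 'a list)) = UNIV"
proof -
  obtain S :: "'a set" where S: "finite S" "rat_vs.span S = UNIV"
    using ex_finite_rat_span by blast
  obtain B where B: "B \<subseteq> S" "rat_vs.independent B" "S \<subseteq> rat_vs.span B"
    using rat_vs.maximal_independent_subset by blast
  have "rat_vs.span B = UNIV"
    using S(2) B(3) rat_vs.span_minimal[OF B(3) rat_vs.subspace_span] by auto
  moreover obtain bs where "set bs = B" "distinct bs"
    using finite_distinct_list[OF finite_subset[OF B(1) S(1)]] by blast
  ultimately have "\<exists>bs :: 'a list. distinct bs \<and> rat_vs.independent (set bs)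
      \<and> rat_vs.span (set bs) = UNIV"
    using B(2) by blast
  from someI_ex[OF this, folded rat_basis_def]
  show "distinct (rat_basis :: 'a list)" "rat_vs.independent (set (rat_basis :: 'a list))"
    "rat_vs.span (set (rat_basis :: 'a list)) = UNIV" by blast+
qed

definition field_degree :: "'a :: number_field itself \<Rightarrow> nat" where
  "field_degree _ = rat_vs.dim (UNIV :: 'a set)"

definition totally_real :: "'a :: number_field itself \<Rightarrow> bool" where
  "totally_real _ \<longleftrightarrow> (\<forall>\<sigma> :: 'a \<Rightarrow> complex. field_hom \<sigma> \<longrightarrow> range \<sigma> \<subseteq> \<real>)"

text \<open>The norm is the determinant of multiplication by \<open>x\<close>, computed in any rational basis.\<close>

definition field_norm :: "'a :: number_field \<Rightarrow> rat" where
  "field_norm x =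
     (let n = length (rat_basis :: 'a list)
      in Determinant.det (Matrix.mat n n (\<lambda>(i, j).
           rat_vs.representation (set rat_basis) (x * rat_basis ! j) (rat_basis ! i))))"

definition ring_of_integers :: "'a :: number_field set" where
  "ring_of_integers = {x. algebraic_int x}"

definition fractional_ideal :: "'a :: number_field set \<Rightarrow> bool" where
  "fractional_ideal I \<longleftrightarrow>
     0 \<in> I \<and> I \<noteq> {0} \<and>
     (\<forall>x\<in>I. \<forall>y\<in>I. x + y \<in> I) \<and>
     (\<forall>a\<in>ring_of_integers. \<forall>x\<in>I. a * x \<in> I) \<and>
     (\<exists>d\<in>ring_of_integers. d \<noteq> 0 \<and> (\<forall>x\<in>I. d * x \<in> ring_of_integers))"


section \<open>The tensor product of a number field with the reals\<close>

instantiation poly_mapping :: (type, real_vector) real_vector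
begin

lift_definition scaleR_poly_mapping ::
    "real \<Rightarrow> ('a \<Rightarrow>\<^sub>0 'b :: real_vector) \<Rightarrow> ('a \<Rightarrow>\<^sub>0 'b)"
  is "\<lambda>c f x. c *\<^sub>R f x"
  by (erule finite_subset[rotated]) auto

instance
  by standard (transfer; simp add: fun_eq_iff scaleR_add_left scaleR_add_right)+

end

text \<open>
  The real vector space obtained from \<open>F\<close> by extension of scalars is the free real vector space
  on the underlying set of \<open>F\<close> modulo the relations making \<open>x \<mapsto> [x]\<close> linear over the rationals.
  A formal sum with coefficients \<open>t\<^sub>i\<close> at \<open>x\<^sub>i\<close> represents the tensor
  \<open>\<Sum> x\<^sub>i \<otimes> t\<^sub>i\<close>.
\<close>

definition tensor_relations :: "('a :: number_field \<Rightarrow>\<^sub>0 real) set" where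
  "tensor_relations =
     {Poly_Mapping.single (x + y) 1 - Poly_Mapping.single x 1 - Poly_Mapping.single y 1 | x y. True} \<union>
     {Poly_Mapping.single (of_rat q * x) 1 - of_rat q *\<^sub>R Poly_Mapping.single x 1 | q x. True}"

quotient_type (overloaded) 'a real_tensor =
  "'a :: number_field \<Rightarrow>\<^sub>0 real" / "\<lambda>u v. u - v \<in> span tensor_relations"
  morphisms rep_real_tensor abs_real_tensor
proof (rule equivpI)
  show "reflp (\<lambda>u v :: 'a \<Rightarrow>\<^sub>0 real. u - v \<in> span tensor_relations)"
    by (rule reflpI) (simp add: span_zero)
  show "symp (\<lambda>u v :: 'a \<Rightarrow>\<^sub>0 real. u - v \<in> span tensor_relations)"
    by (rule sympI) (metis minus_diff_eq span_neg)
  show "transp (\<lambda>u v :: 'a \<Rightarrow>\<^sub>0 real. u - v \<in> span tensor_relations)"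
  proof (rule transpI)
    fix u v w :: "'a \<Rightarrow>\<^sub>0 real"
    assume "u - v \<in> span tensor_relations" "v - w \<in> span tensor_relations"
    from span_add[OF this] show "u - w \<in> span tensor_relations" by simp
  qed
qed

instantiation real_tensor :: (number_field) real_vector
begin

lift_definition zero_real_tensor :: "'a real_tensor" is 0 .

lift_definition plus_real_tensor :: "'a real_tensor \<Rightarrow> 'a real_tensor \<Rightarrow> 'a real_tensor" is "(+)"
proof -
  fix u v u' v' :: "'a \<Rightarrow>\<^sub>0 real"
  assume "u - v \<in> span tensor_relations" "u' - v' \<in> span tensor_relations"
  from span_add[OF this] show "u + u' - (v + v') \<in> span tensor_relations"
    by (simp add: algebra_simps)
qed

lift_definition uminus_real_tensor :: "'a real_tensor \<Rightarrow> 'a real_tensor" is uminus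
  by (metis minus_diff_commute minus_diff_eq diff_minus_eq_add add.commute uminus_add_conv_diff span_neg)

lift_definition minus_real_tensor :: "'a real_tensor \<Rightarrow> 'a real_tensor \<Rightarrow> 'a real_tensor" is "(-)"
proof -
  fix u v u' v' :: "'a \<Rightarrow>\<^sub>0 real"
  assume "u - v \<in> span tensor_relations" "u' - v' \<in> span tensor_relations"
  from span_diff[OF this] show "u - u' - (v - v') \<in> span tensor_relations"
    by (simp add: algebra_simps)
qed

lift_definition scaleR_real_tensor :: "real \<Rightarrow> 'a real_tensor \<Rightarrow> 'a real_tensor" is scaleR
  by (metis scaleR_diff_right span_scale)

instance
  by standard (transfer; simp add: algebra_simps span_zero)+

end

text \<open>The canonical map \<open>x \<mapsto> x \<otimes> 1\<close>.\<close>

lift_definition to_tensor :: "'a :: number_field \<Rightarrow> 'a real_tensor" is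
  "\<lambda>x. Poly_Mapping.single x 1" .

lemma to_tensor_add: "to_tensor (x + y) = to_tensor x + to_tensor y"
  by transfer (auto simp: tensor_relations_def diff_diff_add[symmetric] intro!: span_base)

lemma to_tensor_scale: "to_tensor (of_rat q * x) = of_rat q *\<^sub>R to_tensor x"
  by transfer (auto simp: tensor_relations_def intro!: span_base)

lemma to_tensor_0: "to_tensor 0 = 0"
  using to_tensor_scale[of 0 0] by simp

lemma to_tensor_sum: "to_tensor (\<Sum>i\<in>A. f i) = (\<Sum>i\<in>A. to_tensor (f i))"
  by (induction A rule: infinite_finite_induct) (simp_all add: to_tensor_0 to_tensor_add)

lemma free_vector_expansion:
  "u = (\<Sum>x\<in>Poly_Mapping.keys u. Poly_Mapping.lookup u x *\<^sub>R Poly_Mapping.single x (1 :: real))"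
proof (rule poly_mapping_eqI)
  fix k
  have "Poly_Mapping.lookup
      (\<Sum>x\<in>Poly_Mapping.keys u. Poly_Mapping.lookup u x *\<^sub>R Poly_Mapping.single x (1 :: real)) k =
    (\<Sum>x\<in>Poly_Mapping.keys u. if x = k then Poly_Mapping.lookup u x else 0)"
    unfolding lookup_sum
    by (intro sum.cong) (auto simp: scaleR_poly_mapping.rep_eq lookup_single when_def)
  also have "\<dots> = Poly_Mapping.lookup u k"
    by (simp add: in_keys_iff)
  finally show "Poly_Mapping.lookup u k = Poly_Mapping.lookup
      (\<Sum>x\<in>Poly_Mapping.keys u. Poly_Mapping.lookup u x *\<^sub>R Poly_Mapping.single x (1 :: real)) k"
    by simp
qed

lemma abs_real_tensor_add:
  "abs_real_tensor (u + v) = abs_real_tensor u + abs_real_tensor v"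
  by (simp add: plus_real_tensor.abs_eq)

lemma abs_real_tensor_scaleR: "abs_real_tensor (c *\<^sub>R u) = c *\<^sub>R abs_real_tensor u"
  by (simp add: scaleR_real_tensor.abs_eq)

lemma abs_real_tensor_sum:
  "abs_real_tensor (\<Sum>i\<in>A. f i) = (\<Sum>i\<in>A. abs_real_tensor (f i))"
  by (induction A rule: infinite_finite_induct)
     (simp_all add: abs_real_tensor_add zero_real_tensor.abs_eq)

lemma abs_real_tensor_eq:
  "abs_real_tensor u = (\<Sum>x\<in>Poly_Mapping.keys u. Poly_Mapping.lookup u x *\<^sub>R to_tensor x)"
  by (subst (1) free_vector_expansion)
     (simp add: abs_real_tensor_sum abs_real_tensor_scaleR to_tensor.abs_eq)


subsection \<open>Coordinates and topology\<close>

definition free_coord :: "('a :: number_field \<Rightarrow>\<^sub>0 real) \<Rightarrow> 'a \<Rightarrow> real" where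
  "free_coord u b = (\<Sum>x\<in>Poly_Mapping.keys u.
     Poly_Mapping.lookup u x * of_rat (rat_vs.representation (set rat_basis) x b))"

lemma free_coord_superset:
  assumes "finite A" "Poly_Mapping.keys u \<subseteq> A"
  shows "free_coord u b = (\<Sum>x\<in>A.
     Poly_Mapping.lookup u x * of_rat (rat_vs.representation (set rat_basis) x b))"
  unfolding free_coord_def using assms
  by (intro sum.mono_neutral_left) (auto simp: in_keys_iff)

lemma free_coord_add: "free_coord (u + v) b = free_coord u b + free_coord v b"
proof -
  let ?A = "Poly_Mapping.keys u \<union> Poly_Mapping.keys v \<union> Poly_Mapping.keys (u + v)"
  show ?thesis
    by (subst (1 2 3) free_coord_superset[of ?A])
       (auto simp: lookup_add algebra_simps sum.distrib)
qed

lemma free_coord_scaleR: "free_coord (c *\<^sub>R u) b = c * free_coord u b"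
proof -
  let ?A = "Poly_Mapping.keys u \<union> Poly_Mapping.keys (c *\<^sub>R u)"
  show ?thesis
    by (subst (1 2) free_coord_superset[of ?A])
       (auto simp: scaleR_poly_mapping.rep_eq sum_distrib_left mult.assoc)
qed

lemma free_coord_diff: "free_coord (u - v) b = free_coord u b - free_coord v b"
  using free_coord_add[of u "(-1) *\<^sub>R v" b] free_coord_scaleR[of "-1" v b] by simp

lemma free_coord_single:
  "free_coord (Poly_Mapping.single x 1) b = of_rat (rat_vs.representation (set rat_basis) x b)"
  by (simp add: free_coord_def)

lemma free_coord_relations:
  assumes "u \<in> span tensor_relations"
  shows "free_coord u b = 0"
  using assms
proof (induction rule: span_induct_alt)
  case base
  show ?case by (simp add: free_coord_def)
next
  case (step c r u)
  have "x \<in> rat_vs.span (set rat_basis)" for x :: 'a by (simp add: span_rat_basis)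
  with step.hyps(1) have "free_coord r b = 0"
    by (auto simp: tensor_relations_def free_coord_diff free_coord_single free_coord_scaleR
        rat_vs.representation_add[OF independent_rat_basis]
        rat_vs.representation_scale[OF independent_rat_basis] of_rat_add of_rat_mult)
  with step.IH show ?case by (simp add: free_coord_add free_coord_scaleR)
qed

lift_definition tensor_coord :: "'a :: number_field real_tensor \<Rightarrow> 'a \<Rightarrow> real" is free_coord
  by (auto simp: fun_eq_iff dest: free_coord_relations simp: free_coord_diff)

lemma tensor_coord_add: "tensor_coord (s + t) b = tensor_coord s b + tensor_coord t b"
  by transfer (rule free_coord_add)

lemma tensor_coord_scaleR: "tensor_coord (c *\<^sub>R s) b = c * tensor_coord s b"
  by transfer (rule free_coord_scaleR)

lemma tensor_coord_0: "tensor_coord 0 b = 0"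
  using tensor_coord_scaleR[of 0 0 b] by simp

lemma tensor_coord_sum: "tensor_coord (\<Sum>i\<in>A. f i) b = (\<Sum>i\<in>A. tensor_coord (f i) b)"
  by (induction A rule: infinite_finite_induct) (simp_all add: tensor_coord_0 tensor_coord_add)

lemma tensor_coord_to_tensor:
  "tensor_coord (to_tensor x) b = of_rat (rat_vs.representation (set rat_basis) x b)"
  by transfer (rule free_coord_single)

lemma tensor_coord_to_tensor_basis:
  assumes "b \<in> set rat_basis"
  shows "tensor_coord (to_tensor b) b' = (if b' = b then 1 else 0)"
  using rat_vs.representation_basis[OF independent_rat_basis assms]
  by (simp add: tensor_coord_to_tensor)

lemma to_tensor_expansion:
  "to_tensor x = (\<Sum>b\<in>set rat_basis. tensor_coord (to_tensor x) b *\<^sub>R to_tensor b)"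
proof -
  have "x = (\<Sum>b\<in>set rat_basis. of_rat (rat_vs.representation (set rat_basis) x b) * b)"
    using rat_vs.sum_representation_eq[OF independent_rat_basis, of x "set rat_basis"]
    by (simp add: span_rat_basis)
  from arg_cong[OF this, of to_tensor] show ?thesis
    unfolding to_tensor_sum to_tensor_scale tensor_coord_to_tensor .
qed

lemma tensor_expansion: "t = (\<Sum>b\<in>set rat_basis. tensor_coord t b *\<^sub>R to_tensor b)"
proof -
  obtain u where t: "t = abs_real_tensor u" by (metis Quotient3_abs_rep Quotient3_real_tensor)
  let ?K = "Poly_Mapping.keys u" and ?f = "Poly_Mapping.lookup u"
  have "t = (\<Sum>x\<in>?K. ?f x *\<^sub>R to_tensor x)"
    unfolding t by (rule abs_real_tensor_eq)
  also have "\<dots> = (\<Sum>x\<in>?K. \<Sum>b\<in>set rat_basis. (?f x * tensor_coord (to_tensor x) b) *\<^sub>R to_tensor b)"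
    by (subst to_tensor_expansion) (simp add: scaleR_sum_right)
  also have "\<dots> = (\<Sum>b\<in>set rat_basis. (\<Sum>x\<in>?K. ?f x * tensor_coord (to_tensor x) b) *\<^sub>R to_tensor b)"
    by (subst sum.swap) (simp add: scaleR_sum_left)
  also have "\<dots> = (\<Sum>b\<in>set rat_basis. tensor_coord t b *\<^sub>R to_tensor b)"
    unfolding t by (simp add: abs_real_tensor_eq tensor_coord_sum tensor_coord_scaleR)
  finally show ?thesis .
qed

lemma tensor_eqI: "(\<And>b. b \<in> set rat_basis \<Longrightarrow> tensor_coord s b = tensor_coord t b) \<Longrightarrow> s = t"
  by (subst (1 2) tensor_expansion) simp

text \<open>
  The inner product depends on the chosen rational basis, but it only serves to provide the
  topology, which on a finite-dimensional real vector space is the same for every inner product.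
\<close>

instantiation real_tensor :: (number_field) euclidean_space
begin

definition inner_real_tensor :: "'a real_tensor \<Rightarrow> 'a real_tensor \<Rightarrow> real" where
  "inner s t = (\<Sum>b\<in>set rat_basis. tensor_coord s b * tensor_coord t b)"

definition norm_real_tensor :: "'a real_tensor \<Rightarrow> real" where
  "norm (t :: 'a real_tensor) = sqrt (inner t t)"

definition sgn_real_tensor :: "'a real_tensor \<Rightarrow> 'a real_tensor" where
  "sgn (t :: 'a real_tensor) = t /\<^sub>R norm t"

definition dist_real_tensor :: "'a real_tensor \<Rightarrow> 'a real_tensor \<Rightarrow> real" where
  "dist (s :: 'a real_tensor) t = norm (s - t)"

definition uniformity_real_tensor :: "('a real_tensor \<times> 'a real_tensor) filter" where
  "uniformity = (INF e\<in>{0 <..}. principal {(x, y :: 'a real_tensor). dist x y < e})"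

definition open_real_tensor :: "'a real_tensor set \<Rightarrow> bool" where
  "open (U :: 'a real_tensor set) \<longleftrightarrow> (\<forall>x\<in>U. eventually (\<lambda>(x', y). x' = x \<longrightarrow> y \<in> U) uniformity)"

definition Basis_real_tensor :: "'a real_tensor set" where
  "Basis = to_tensor ` set rat_basis"

instance
proof
  fix r s t :: "'a real_tensor" and c :: real
  show "inner s t = inner t s"
    by (simp add: inner_real_tensor_def mult.commute)
  show "inner (r + s) t = inner r t + inner s t"
    by (simp add: inner_real_tensor_def tensor_coord_add distrib_right sum.distrib)
  show "inner (c *\<^sub>R s) t = c * inner s t"
    by (simp add: inner_real_tensor_def tensor_coord_scaleR sum_distrib_left mult.assoc)
  show "0 \<le> inner s s"
    by (simp add: inner_real_tensor_def sum_nonneg)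
  show "inner s s = 0 \<longleftrightarrow> s = 0"
  proof
    assume "inner s s = 0"
    then have "tensor_coord s b = 0" if "b \<in> set rat_basis" for b
      using that by (simp add: inner_real_tensor_def sum_nonneg_eq_0_iff)
    then show "s = 0" by (intro tensor_eqI) (simp add: tensor_coord_0)
  qed (simp add: inner_real_tensor_def tensor_coord_0)
  show "(Basis :: 'a real_tensor set) \<noteq> {}"
  proof
    assume "(Basis :: 'a real_tensor set) = {}"
    then have "rat_vs.span {} = (UNIV :: 'a set)"
      using span_rat_basis[where 'a = 'a] by (simp add: Basis_real_tensor_def)
    then have "(1 :: 'a) \<in> {0}" by (metis UNIV_I rat_vs.span_empty)
    then show False by simp
  qed
  show "finite (Basis :: 'a real_tensor set)"
    by (simp add: Basis_real_tensor_def)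
  have inner_basis: "inner t (to_tensor b) = tensor_coord t b" if "b \<in> set rat_basis" for t and b :: 'a
    using that by (simp add: inner_real_tensor_def tensor_coord_to_tensor_basis if_distrib
        cong: if_cong)
  show "inner s t = (if s = t then 1 else 0)" if "s \<in> Basis" "t \<in> Basis"
  proof -
    obtain b b' where b: "b \<in> set rat_basis" "s = to_tensor b" "b' \<in> set rat_basis" "t = to_tensor b'"
      using \<open>s \<in> Basis\<close> \<open>t \<in> Basis\<close> by (auto simp: Basis_real_tensor_def)
    have "b = b'" if "s = t"
      using tensor_coord_to_tensor_basis[OF b(1), of b] tensor_coord_to_tensor_basis[OF b(3), of b]
        that b by (auto split: if_splits)
    then show ?thesis
      using b by (auto simp: inner_basis tensor_coord_to_tensor_basis)
  qed
  show "(\<forall>u\<in>Basis. inner s u = 0) \<longleftrightarrow> s = 0"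
    using tensor_eqI[of s 0] by (auto simp: Basis_real_tensor_def inner_basis tensor_coord_0)
qed (rule norm_real_tensor_def sgn_real_tensor_def dist_real_tensor_def
    uniformity_real_tensor_def open_real_tensor_def)+

end


section \<open>Admissible bases\<close>

definition Q_map :: "'a :: number_field \<Rightarrow> 'a" where
  "Q_map x = of_rat (field_norm x) / x"

text \<open>
  The interior is taken relative to the linear span, not the affine hull as \<^const>\<open>rel_interior\<close>
  would do.
\<close>

definition no_half_space :: "'a :: number_field set \<Rightarrow> bool" where
  "no_half_space S \<longleftrightarrow>
     0 \<in> top_of_set (span (to_tensor ` S)) interior_of (convex hull (to_tensor ` S))"

definition int_basis :: "'a :: number_field list \<Rightarrow> 'a set \<Rightarrow> bool" where
  "int_basis rs I \<longleftrightarrow>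
     distinct rs \<and> int_mod.independent (set rs) \<and> int_mod.span (set rs) = I"

definition admissible_basis :: "'a :: number_field \<times> 'a \<times> 'a \<Rightarrow> 'a set \<Rightarrow> bool" where
  "admissible_basis = (\<lambda>(r1, r2, r3) I.
     int_basis [r1, r2, r3] I \<and> no_half_space {Q_map r1, Q_map r2, Q_map r3})"

end

theory Submission
  imports Defs "Jordan_Normal_Form.Char_Poly"
begin

text \<open>
  The ring of integers has a basis \<open>1, a t, a t\<^sup>2 + b t\<close> with \<open>a t\<^sup>3 + b t\<^sup>2 + c t + d = 0\<close>
  (Delone--Faddeev), so \<open>\<langle>1, t, t\<^sup>2\<rangle>\<close> is a fractional ideal. For a superbasis
  \<open>v\<^sub>1 + v\<^sub>2 + v\<^sub>3 = 0\<close> of the integer lattice in the plane, with \<open>v\<^sub>i = (x\<^sub>i, y\<^sub>i)\<close>, put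
  \<open>l\<^sub>i = x\<^sub>i - y\<^sub>i t\<close>. The products \<open>l\<^sub>2 l\<^sub>3, l\<^sub>1 l\<^sub>3, l\<^sub>1 l\<^sub>2\<close> form a basis of this ideal, and their
  images under \<open>Q\<close> are proportional to \<open>l\<^sub>i / N(l\<^sub>i)\<close> with a common factor. As the
  \<open>l\<^sub>i\<close> sum to zero, the basis is admissible once all \<open>N(l\<^sub>i)\<close> have the same sign, which means that each
  of the three arcs of the projective line between the real conjugates of \<open>t\<close> contains one
  \<open>x\<^sub>i / y\<^sub>i\<close>. Such a triangle of the Farey tessellation exists: it is the median of the three
  conjugates, viewed as ends of the dual tree.
\<close>

subsection \<open>Separating superbases\<close>

text \<open>The interior is taken in the linear span, and a triangle has no interior in a space of
  dimension three. So the three images under \<open>Q_map\<close> must be linearly dependent, with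
  positive coefficients. As \<open>Q_map r\<close> is a rational multiple of \<open>1 / r\<close>,
  the reciprocals of the basis elements must be dependent, and an arbitrary basis will not do. This
  is the origin of the products: their reciprocals are the three linear forms divided by one common
  denominator, and three forms in a lattice of rank two always satisfy a relation. A second obstacle
  is stability under all integers. For an arbitrary irrational t, the span of 1, t, t^2 may be
  stable only under a smaller order, so t has to be read off from an integral basis, at the price
  that t itself need not be integral. Total reality splits the norm of x - y t into three real
  linear factors, so that its sign can be read off from the position of x / y among the conjugates.
  The conjugates are irrational, which makes all these comparisons strict.\<close>

lemma irrational_linear_form_nonzero:
  fixes \<alpha> :: real and x y :: int
  assumes "\<alpha> \<notin> \<rat>" "y \<noteq> 0"
  shows "x \<noteq> y * \<alpha>"
proof
  assume "x = y * \<alpha>"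
  with \<open>y \<noteq> 0\<close> have "\<alpha> = x / y" by (simp add: field_simps)
  with assms(1) show False by simp
qed

text \<open>Neighbouring fractions differ by 1 / (y y'), and here they enclose a gap of length
  \<beta> - \<alpha>, so y and y' are at most 1 / (\<beta> - \<alpha>) when y' > 0. The summand 1 in
  \<open>C\<close> covers y' = 0, where y = 1. The numerators follow: x from x < y \<alpha>, and x'
  from x' \<le> x' y = 1 + x y'. The four summands bound x, y, x', y' in this order. This is the
  termination bound of the descent.\<close>

lemma unimodular_pair_bounded:
  fixes x y x' y' :: int and \<alpha> \<beta> :: real
  assumes "0 < \<alpha>" "\<alpha> < \<beta>" "x' * y - x * y' = 1" "0 \<le> x" "0 \<le> y" "0 \<le> x'" "0 \<le> y'"
    and "x < y * \<alpha>" "y' * \<beta> < x'"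
  defines "C \<equiv> 1 + 1 / (\<beta> - \<alpha>)"
  shows "x + y + x' + y' \<le> \<alpha> * C + C + (1 + \<alpha> * C * C) + C"
proof -
  have pos: "y > 0" using assms(1,4,5,8) by (cases "y = 0") auto
  have C: "1 \<le> C" using assms(2) by (simp add: C_def)
  have one: "real_of_int x' * y - x * y' = 1" using arg_cong[OF assms(3), of real_of_int] by simp
  have yC: "y \<le> C"
  proof (cases "y' = 0")
    case True
    then have "x' * y = 1" using assms(3) by simp
    then have "y = 1" using pos by (simp add: zmult_eq_1_iff)
    then show ?thesis using C by simp
  next
    case False
    then have "1 \<le> real_of_int y'" using assms(7) by linarith
    have "(\<beta> - \<alpha>) * y \<le> \<beta> * y - x" using assms(8) by (simp add: algebra_simps)
    also have "\<dots> \<le> y' * (\<beta> * y - x)"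
    proof -
      have "0 \<le> (\<beta> - \<alpha>) * y" using assms(2) pos by simp
      then have "0 \<le> \<beta> * y - x" using assms(8) by (simp add: algebra_simps)
      then show ?thesis using mult_right_mono[OF \<open>1 \<le> real_of_int y'\<close>] by fastforce
    qed
    also have "\<dots> \<le> 1"
    proof -
      have "0 \<le> (x' - y' * \<beta>) * y" using assms(9) pos by simp
      then show ?thesis using one by (simp add: algebra_simps)
    qed
    finally show ?thesis using assms(2) unfolding C_def by (simp add: field_simps)
  qed
  have y'C: "y' \<le> C"
  proof -
    have "(\<beta> - \<alpha>) * y' \<le> x' - y' * \<alpha>" using assms(9) by (simp add: algebra_simps)
    also have "\<dots> \<le> (x' - y' * \<alpha>) * y"
    proof -
      have "0 \<le> (\<beta> - \<alpha>) * y'" using assms(2,7) by simp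
      then have "0 \<le> x' - y' * \<alpha>" using assms(9) by (simp add: algebra_simps)
      then show ?thesis using mult_left_mono[of 1 "real_of_int y"] pos by fastforce
    qed
    also have "\<dots> \<le> 1"
    proof -
      have "0 \<le> y' * (\<alpha> * y - x)" using assms(7,8) by (simp add: mult.commute)
      then show ?thesis using one by (simp add: algebra_simps)
    qed
    finally show ?thesis using assms(2) unfolding C_def by (simp add: field_simps)
  qed
  have "y * \<alpha> \<le> \<alpha> * C" using yC assms(1) by simp
  then have xC: "x \<le> \<alpha> * C" using assms(8) by linarith
  have "x' \<le> real_of_int x' * y" using mult_left_mono[of 1 "real_of_int y" x'] pos assms(6) by simp
  also have "\<dots> = 1 + real_of_int x * y'" using one by simp
  also have "\<dots> \<le> 1 + \<alpha> * C * C" using xC y'C assms(4,7) assms(1) C by (simp add: mult_mono)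
  finally show ?thesis using xC yC y'C by simp
qed

text \<open>Descent in the Farey tree: the interval \<open>(x / y, x' / y')\<close> is bisected at its mediant until the
  mediant separates \<open>\<alpha>\<close> from \<open>\<beta>\<close>. The last two conjuncts record that the final interval is nested
  in the first one, in a form that allows \<open>y' = 0\<close>.\<close>

lemma farey_separation:
  fixes x y x' y' :: int and \<alpha> \<beta> :: real
  assumes "\<alpha> \<notin> \<rat>" "\<beta> \<notin> \<rat>" "0 < \<alpha>" "\<alpha> < \<beta>"
    and "x' * y - x * y' = 1" "0 \<le> x" "0 \<le> y" "0 \<le> x'" "0 \<le> y'"
    and "x < y * \<alpha>" "y' * \<beta> < x'"
  shows "\<exists>u v u' v' :: int. u' * v - u * v' = 1 \<and> 0 \<le> u \<and> 0 \<le> v \<and> 0 \<le> u' \<and> 0 \<le> v'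
    \<and> u < v * \<alpha> \<and> v' * \<beta> < u' \<and> real_of_int (v + v') * \<alpha> < real_of_int (u + u')
    \<and> real_of_int (u + u') < real_of_int (v + v') * \<beta>
    \<and> (\<forall>\<gamma>::real. \<gamma> < \<alpha> \<longrightarrow> y * \<gamma> < x \<longrightarrow> v * \<gamma> < u)
    \<and> (\<forall>\<gamma>::real. \<gamma> > \<beta> \<longrightarrow> x' < y' * \<gamma> \<longrightarrow> u' < v' * \<gamma>)"
proof -
  define C where "C = 1 + 1 / (\<beta> - \<alpha>)"
  define N where "N = \<lceil>\<alpha> * C + C + (1 + \<alpha> * C * C) + C\<rceil>"
  have bound: "x + y + x' + y' \<le> N"
    if "x' * y - x * y' = 1" "0 \<le> x" "0 \<le> y" "0 \<le> x'" "0 \<le> y'" "x < y * \<alpha>" "y' * \<beta> < x'"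
    for x y x' y' :: int
    using unimodular_pair_bounded[OF assms(3,4) that, folded C_def] unfolding N_def
    by linarith
  show ?thesis using assms(5-)
  proof (induction "nat (N - (x + y + x' + y'))" arbitrary: x y x' y' rule: less_induct)
    case less
    note h = less.prems
    have pos: "y > 0" using assms(3) h(2,3,6) by (cases "y = 0") auto
    have pos': "x' > 0"
      using h(4,5,7) assms(3,4) by (cases "x' = 0") (auto simp: mult_less_0_iff)
    have ne: "x + x' \<noteq> (y + y') * \<alpha>" "x + x' \<noteq> (y + y') * \<beta>"
      using irrational_linear_form_nonzero[OF assms(1), of "y + y'" "x + x'"]
        irrational_linear_form_nonzero[OF assms(2), of "y + y'" "x + x'"] pos h(5) by auto
    consider "(y + y') * \<alpha> < x + x'" "x + x' < (y + y') * \<beta>"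
      | "x + x' < (y + y') * \<alpha>" | "(y + y') * \<beta> < x + x'" using ne by linarith
    then show ?case
    proof cases
      case 1
      with h show ?thesis
        by - (rule exI[of _ x], rule exI[of _ y], rule exI[of _ x'], rule exI[of _ y'], blast)
    next
      case 2
      have uni: "x' * (y + y') - (x + x') * y' = 1" using h(1) by (simp add: algebra_simps)
      have nn: "0 \<le> x + x'" "0 \<le> y + y'" using h by auto
      have lt: "real_of_int (x + x') < real_of_int (y + y') * \<alpha>" using 2 by simp
      \<comment> \<open>The sum of the entries grows by x' + y' > 0 and, by \<open>bound\<close> for
        the new pair, still does not exceed \<open>N\<close>; so the truncated difference really
        decreases.\<close>
      have "nat (N - (x + x' + (y + y') + x' + y')) < nat (N - (x + y + x' + y'))"
        using bound[OF uni nn h(4,5) lt h(7)] pos' h(5) by linarith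
      from less.hyps[OF this uni nn h(4,5) lt h(7)] obtain u v u' v' :: int where
        uv: "u' * v - u * v' = 1" "0 \<le> u" "0 \<le> v" "0 \<le> u'" "0 \<le> v'"
        "u < v * \<alpha>" "v' * \<beta> < u'" "real_of_int (v + v') * \<alpha> < real_of_int (u + u')"
        "real_of_int (u + u') < real_of_int (v + v') * \<beta>"
        and nest: "\<forall>\<gamma>::real. \<gamma> < \<alpha> \<longrightarrow> (y + y') * \<gamma> < x + x' \<longrightarrow> v * \<gamma> < u"
        "\<forall>\<gamma>::real. \<gamma> > \<beta> \<longrightarrow> x' < y' * \<gamma> \<longrightarrow> u' < v' * \<gamma>"
        by (elim exE conjE) (rule that)
      \<comment> \<open>The left end has moved to the mediant, so the nesting hypothesis must be
        moved along: \<gamma> < \<beta> puts \<gamma> below the right end too, and the two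
        inequalities add up, even when y' = 0.\<close>
      have "(y + y') * \<gamma> < x + x'" if "\<gamma> < \<alpha>" "y * \<gamma> < x" for \<gamma> :: real
      proof -
        have "y' * \<gamma> \<le> y' * \<beta>" using that(1) assms(4) h(5) by (intro mult_left_mono) auto
        then show ?thesis using that(2) h(7) by (simp add: algebra_simps)
      qed
      with nest uv show ?thesis
        by - (rule exI[of _ u], rule exI[of _ v], rule exI[of _ u'], rule exI[of _ v'], blast)
    next
      case 3
      have uni: "(x + x') * y - x * (y + y') = 1" using h(1) by (simp add: algebra_simps)
      have nn: "0 \<le> x + x'" "0 \<le> y + y'" using h by auto
      have lt: "real_of_int (y + y') * \<beta> < real_of_int (x + x')" using 3 by simp
      have "nat (N - (x + y + (x + x') + (y + y'))) < nat (N - (x + y + x' + y'))"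
        using bound[OF uni h(2,3) nn h(6) lt] pos h(2) by linarith
      from less.hyps[OF this uni h(2,3) nn h(6) lt] obtain u v u' v' :: int where
        uv: "u' * v - u * v' = 1" "0 \<le> u" "0 \<le> v" "0 \<le> u'" "0 \<le> v'"
        "u < v * \<alpha>" "v' * \<beta> < u'" "real_of_int (v + v') * \<alpha> < real_of_int (u + u')"
        "real_of_int (u + u') < real_of_int (v + v') * \<beta>"
        and nest: "\<forall>\<gamma>::real. \<gamma> < \<alpha> \<longrightarrow> y * \<gamma> < x \<longrightarrow> v * \<gamma> < u"
        "\<forall>\<gamma>::real. \<gamma> > \<beta> \<longrightarrow> x + x' < (y + y') * \<gamma> \<longrightarrow> u' < v' * \<gamma>"
        by (elim exE conjE) (rule that)
      have "x + x' < (y + y') * \<gamma>" if "\<gamma> > \<beta>" "x' < y' * \<gamma>" for \<gamma> :: real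
      proof -
        have "y * \<alpha> \<le> y * \<gamma>" using that(1) assms(4) h(3) by (intro mult_left_mono) auto
        then show ?thesis using that(2) h(6) by (simp add: algebra_simps)
      qed
      with nest uv show ?thesis
        by - (rule exI[of _ u], rule exI[of _ v], rule exI[of _ u'], rule exI[of _ v'], blast)
    qed
  qed
qed

section \<open>Signs of a totally split binary cubic form on a superbasis\<close>

text \<open>When \<alpha>, \<beta>, \<gamma> are the conjugates of t, this is the norm of x - y
  t.\<close>

definition cubic_form :: "real \<Rightarrow> real \<Rightarrow> real \<Rightarrow> int \<Rightarrow> int \<Rightarrow> real" where
  "cubic_form \<alpha> \<beta> \<gamma> x y = (x - y * \<alpha>) * (x - y * \<beta>) * (x - y * \<gamma>)"

lemma cubic_form_minus: "cubic_form \<alpha> \<beta> \<gamma> (- x) (- y) = - cubic_form \<alpha> \<beta> \<gamma> x y"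
proof -
  have "of_int (- x) - of_int (- y) * \<delta> = - (of_int x - of_int y * \<delta>)" for \<delta> :: real by simp
  then show ?thesis unfolding cubic_form_def by (simp only: mult_minus_left mult_minus_right minus_minus)
qed

text \<open>Two descents find the median triangle. One separates \<alpha> from \<gamma>; its mediant
  lies on one side of \<beta>, and the half interval that holds \<beta> and another root is
  descended again to separate these two. The nesting conjuncts keep its end on the correct side of
  the third root. In the end each arc between the roots contains one of the three fractions. The
  value at the sum has the opposite sign because the third vector of the superbasis is minus the sum
  and the form has odd degree.\<close>

lemma separating_superbasis_pos:
  assumes "\<alpha> \<notin> \<rat>" "\<beta> \<notin> \<rat>" "\<gamma> \<notin> \<rat>" "0 < \<alpha>" "\<alpha> < \<beta>" "\<beta> < \<gamma>"
  shows "\<exists>x y x' y' :: int. x' * y - x * y' = 1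
    \<and> 0 < cubic_form \<alpha> \<beta> \<gamma> x y * cubic_form \<alpha> \<beta> \<gamma> x' y'
    \<and> cubic_form \<alpha> \<beta> \<gamma> x y * cubic_form \<alpha> \<beta> \<gamma> (x + x') (y + y') < 0"
proof -
  have "\<alpha> < \<gamma>" using assms by simp
  \<comment> \<open>The instances are x', y, x, y' in this order: the descent starts at the interval
    from 0/1 to 1/0, which contains all positive reals.\<close>
  from farey_separation[OF assms(1,3,4) this, of 1 1 0 0] \<open>0 < \<alpha>\<close>
  obtain u v u' v' :: int where u: "u' * v - u * v' = 1" "0 \<le> u" "0 \<le> v" "0 \<le> u'" "0 \<le> v'"
    "u < v * \<alpha>" "v' * \<gamma> < u'" "real_of_int (v + v') * \<alpha> < real_of_int (u + u')" "u + u' < (v + v') * \<gamma>"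
    by auto
  have "v > 0" using assms(4) u(2,3,6) by (cases "v = 0") auto
  then have "u + u' \<noteq> (v + v') * \<beta>"
    using irrational_linear_form_nonzero[OF assms(2), of "v + v'" "u + u'"] u(5) by auto
  then consider "real_of_int (u + u') < real_of_int (v + v') * \<beta>" | "u + u' > (v + v') * \<beta>" by linarith
  then show ?thesis
  proof cases
    case 1
    have "0 < \<beta>" "u' * (v + v') - (u + u') * v' = 1" "0 \<le> u + u'" "0 \<le> v + v'"
     
        "real_of_int (u + u') < real_of_int (v + v') * \<beta>"
      using assms(4,5) u 1 by (auto simp: algebra_simps)
    \<comment> \<open>The mediant is now the left end and exceeds \<alpha>; nesting, applied at
      \<alpha>, gives \<open>y * \<alpha> < x\<close> for the final left end.\<close>
    from farey_separation[OF assms(2,3) this(1) assms(6) this(2-4) u(4,5) this(5) u(7)] u(8) assms(5)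
    obtain x y x' y' :: int where h: "x' * y - x * y' = 1" "0 \<le> x" "0 \<le> y" "0 \<le> x'" "0 \<le> y'"
      "x < y * \<beta>" "y' * \<gamma> < x'" "(y + y') * \<beta> < x + x'" "x + x' < (y + y') * \<gamma>" "y * \<alpha> < x"
      by auto
    have "0 < cubic_form \<alpha> \<beta> \<gamma> x y"
    proof -
      have "y * \<beta> \<le> y * \<gamma>" using h(3) assms(6) by (intro mult_left_mono) auto
      then show ?thesis unfolding cubic_form_def
        using h by (intro mult_neg_neg mult_pos_neg) auto
    qed
    moreover have "0 < cubic_form \<alpha> \<beta> \<gamma> x' y'"
    proof -
      have "y' * \<beta> \<le> y' * \<gamma>" "y' * \<alpha> \<le> y' * \<gamma>" using h(5) assms(5,6) by (auto intro!: mult_left_mono)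
      then show ?thesis unfolding cubic_form_def
        using h by (intro mult_pos_pos) auto
    qed
    moreover have "cubic_form \<alpha> \<beta> \<gamma> (x + x') (y + y') < 0"
    proof -
      have "(y + y') * \<alpha> \<le> (y + y') * \<beta>" using h(3,5) assms(5,6) by (intro mult_left_mono) auto
      then show ?thesis unfolding cubic_form_def
        using h by (intro mult_pos_pos mult_pos_neg) auto
    qed
    ultimately show ?thesis using h(1) by - (rule exI[of _ x], rule exI[of _ y], rule exI[of _ x'], rule exI[of _ y'],
      simp add: mult_pos_neg)
  next
    case 2
    have "(u + u') * v - u * (v + v') = 1" "0 \<le> u + u'" "0 \<le> v + v'"
      "real_of_int (v + v') * \<beta> < real_of_int (u + u')"
      using u 2 by (auto simp: algebra_simps)
    from farey_separation[OF assms(1,2,4,5) this(1) u(2,3) this(2,3) u(6) this(4)] u(9) assms(6)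
    obtain x y x' y' :: int where h: "x' * y - x * y' = 1" "0 \<le> x" "0 \<le> y" "0 \<le> x'" "0 \<le> y'"
      "x < y * \<alpha>" "y' * \<beta> < x'" "(y + y') * \<alpha> < x + x'" "x + x' < (y + y') * \<beta>" "x' < y' * \<gamma>"
      by auto
    have "cubic_form \<alpha> \<beta> \<gamma> x y < 0"
    proof -
      have "y * \<alpha> \<le> y * \<beta>" "y * \<alpha> \<le> y * \<gamma>" using h(3) assms(5,6) by (auto intro!: mult_left_mono)
      then show ?thesis unfolding cubic_form_def
        using h by (intro mult_neg_neg mult_pos_neg) auto
    qed
    moreover have "cubic_form \<alpha> \<beta> \<gamma> x' y' < 0"
    proof -
      have "y' * \<alpha> \<le> y' * \<beta>" using h(5) assms(5,6) by (auto intro!: mult_left_mono)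
      then show ?thesis unfolding cubic_form_def
        using h by (intro mult_pos_pos mult_pos_neg) auto
    qed
    moreover have "0 < cubic_form \<alpha> \<beta> \<gamma> (x + x') (y + y')"
    proof -
      have "(y + y') * \<beta> \<le> (y + y') * \<gamma>" using h(3,5) assms(5,6) by (intro mult_left_mono) auto
      then show ?thesis unfolding cubic_form_def
        using h by (intro mult_neg_neg mult_pos_neg) auto
    qed
    ultimately show ?thesis using h(1) by - (rule exI[of _ x], rule exI[of _ y], rule exI[of _ x'], rule exI[of _ y'],
      simp add: mult_neg_neg mult_neg_pos)
  qed
qed

text \<open>Translating the roots by the integer part of \<alpha> makes them positive. On integer
  pairs the translation is the shear (x, y) to (x + n y, y), which preserves the determinant, the
  sum of the two vectors and the values of the form.\<close>

lemma separating_superbasis_sorted: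
  assumes "\<alpha> \<notin> \<rat>" "\<beta> \<notin> \<rat>" "\<gamma> \<notin> \<rat>" "\<alpha> < \<beta>" "\<beta> < \<gamma>"
  shows "\<exists>x y x' y' :: int. x' * y - x * y' = 1
    \<and> 0 < cubic_form \<alpha> \<beta> \<gamma> x y * cubic_form \<alpha> \<beta> \<gamma> x' y'
    \<and> cubic_form \<alpha> \<beta> \<gamma> x y * cubic_form \<alpha> \<beta> \<gamma> (x + x') (y + y') < 0"
proof -
  define n where "n = \<lfloor>\<alpha>\<rfloor>"
  have irr: "\<delta> - n \<notin> \<rat>" if "\<delta> \<notin> \<rat>" for \<delta> :: real
    using that Rats_add[of "\<delta> - n" n] by auto
  have "n \<noteq> \<alpha>" using assms(1) by (metis Rats_of_int)
  then have "0 < \<alpha> - n" unfolding n_def by linarith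
  from separating_superbasis_pos[OF irr[OF assms(1)] irr[OF assms(2)] irr[OF assms(3)] this] assms(4,5)
  obtain x y x' y' :: int where h: "x' * y - x * y' = 1"
    "0 < cubic_form (\<alpha> - n) (\<beta> - n) (\<gamma> - n) x y * cubic_form (\<alpha> - n) (\<beta> - n) (\<gamma> - n) x' y'"
    "cubic_form (\<alpha> - n) (\<beta> - n) (\<gamma> - n) x y
      * cubic_form (\<alpha> - n) (\<beta> - n) (\<gamma> - n) (x + x') (y + y') < 0"
    by auto
  have shift: "cubic_form (\<alpha> - n) (\<beta> - n) (\<gamma> - n) x y = cubic_form \<alpha> \<beta> \<gamma> (x + n * y) y" for x y
  proof -
    have "x - y * (\<delta> - n) = real_of_int (x + n * y) - y * \<delta>" for \<delta> :: real
      by (simp add: algebra_simps)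
    then show ?thesis unfolding cubic_form_def by presburger
  qed
  have "(x' + n * y') * y - (x + n * y) * y' = 1" using h(1) by (simp add: algebra_simps)
  moreover have sum: "(x + x') + n * (y + y') = (x + n * y) + (x' + n * y')" by (simp add: algebra_simps)
  ultimately show ?thesis using h(2,3) unfolding shift sum
    by - (rule exI[of _ "x + n * y"], rule exI[of _ y], rule exI[of _ "x' + n * y'"], rule exI[of _ y'],
      blast)
qed

lemma separating_superbasis:
  assumes "\<alpha> \<notin> \<rat>" "\<beta> \<notin> \<rat>" "\<gamma> \<notin> \<rat>" "\<alpha> \<noteq> \<beta>" "\<beta> \<noteq> \<gamma>" "\<alpha> \<noteq> \<gamma>"
  shows "\<exists>x y x' y' :: int. x' * y - x * y' = 1
    \<and> 0 < cubic_form \<alpha> \<beta> \<gamma> x y * cubic_form \<alpha> \<beta> \<gamma> x' y'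
    \<and> cubic_form \<alpha> \<beta> \<gamma> x y * cubic_form \<alpha> \<beta> \<gamma> (x + x') (y + y') < 0"
proof -
  have swap: "cubic_form \<alpha> \<beta> \<gamma> = cubic_form \<beta> \<alpha> \<gamma>" "cubic_form \<alpha> \<beta> \<gamma> = cubic_form \<alpha> \<gamma> \<beta>" for \<alpha> \<beta> \<gamma>
    by (auto simp: cubic_form_def fun_eq_iff)
  consider "\<alpha> < \<beta>" "\<beta> < \<gamma>" | "\<alpha> < \<gamma>" "\<gamma> < \<beta>" | "\<beta> < \<alpha>" "\<alpha> < \<gamma>" | "\<beta> < \<gamma>" "\<gamma> < \<alpha>"
    | "\<gamma> < \<alpha>" "\<alpha> < \<beta>" | "\<gamma> < \<beta>" "\<beta> < \<alpha>"
    using assms by linarith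
  then show ?thesis
  proof cases
    case 1 then show ?thesis using separating_superbasis_sorted assms by blast
  next
    case 2 then show ?thesis
      using separating_superbasis_sorted[of \<alpha> \<gamma> \<beta>] assms by (simp add: swap(2)[of \<alpha> \<beta>])
  next
    case 3 then show ?thesis
      using separating_superbasis_sorted[of \<beta> \<alpha> \<gamma>] assms by (simp add: swap(1)[of \<alpha> \<beta>])
  next
    case 4 then show ?thesis
      using separating_superbasis_sorted[of \<beta> \<gamma> \<alpha>] assms
      by (simp add: swap(1)[of \<alpha> \<beta>] swap(2)[of \<beta> \<alpha>])
  next
    case 5 then show ?thesis
      using separating_superbasis_sorted[of \<gamma> \<alpha> \<beta>] assms
      by (simp add: swap(2)[of \<alpha> \<beta>] swap(1)[of \<alpha> \<gamma>])
  next
    case 6 then show ?thesis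
      using separating_superbasis_sorted[of \<gamma> \<beta> \<alpha>] assms
      by (simp add: swap(1)[of \<alpha> \<beta>] swap(2)[of \<beta> \<alpha>] swap(1)[of \<beta> \<gamma>])
  qed
qed

section \<open>Interior points of a triangle through a positive relation\<close>

text \<open>Dividing the relation by a + b + c exhibits 0 as a convex combination with positive
  weights, hence as a point of the relative interior. Since 0 then lies in the affine hull, affine
  hull and linear span agree, and the relative interior is the interior in the span. Distinctness
  lets sums over the set have three terms.\<close>

lemma zero_interior_convex_hull:
  fixes p q r :: "'v :: euclidean_space"
  assumes "distinct [p, q, r]" and pos: "0 < a" "0 < b" "0 < c"
    and rel: "a *\<^sub>R p + b *\<^sub>R q + c *\<^sub>R r = 0"
  shows "0 \<in> top_of_set (span {p, q, r}) interior_of (convex hull {p, q, r})"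
proof -
  let ?S = "{p, q, r}"
  define s where "s = a + b + c"
  have s: "s > 0" using pos by (simp add: s_def)
  define u where "u x = (if x = p then a else if x = q then b else c) / s" for x
  have u: "u p = a / s" "u q = b / s" "u r = c / s" using assms(1) by (auto simp: u_def)
  have "a / s + b / s + c / s = 1" using s by (simp add: s_def add_divide_distrib[symmetric])
  then have 1: "sum u ?S = 1" using assms(1) by (simp add: u add.assoc)
  have "(\<Sum>x\<in>?S. u x *\<^sub>R x) = (a / s) *\<^sub>R p + ((b / s) *\<^sub>R q + (c / s) *\<^sub>R r)"
    using assms(1) u by simp
  also have "\<dots> = (1 / s) *\<^sub>R (a *\<^sub>R p + b *\<^sub>R q + c *\<^sub>R r)"
    by (simp add: scaleR_add_right add.assoc)
  finally have 2: "(\<Sum>x\<in>?S. u x *\<^sub>R x) = 0" using rel by simp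
  have 3: "\<forall>x\<in>?S. 0 < u x" using pos s by (simp add: u)
  have ri: "0 \<in> rel_interior (convex hull ?S)"
  proof (rule subsetD[OF explicit_subset_rel_interior_convex_hull_minimal])
    show "0 \<in> {y. \<exists>u. (\<forall>x\<in>?S. 0 < u x) \<and> sum u ?S = 1 \<and> (\<Sum>x\<in>?S. u x *\<^sub>R x) = y}"
      unfolding mem_Collect_eq using 1 2 3 by (intro exI[of _ u] conjI)
  qed simp
  have "0 \<in> affine hull ?S"
    by (rule subsetD[OF convex_hull_subset_affine_hull subsetD[OF rel_interior_subset ri]])
  then have "affine hull (convex hull ?S) = span ?S"
    unfolding affine_hull_convex_hull by (rule affine_hull_span_0)
  with ri show ?thesis unfolding rel_interior_def interior_of_def by simp
qed

subsection \<open>Algebraic integers\<close>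

text \<open>The determinant trick: multiplication by x acts on the elements of S through an integer
  matrix. The tuple of these elements is an eigenvector with eigenvalue x, nonzero because of s, so
  x is a root of a monic integer characteristic polynomial.\<close>

lemma algebraic_int_if_stabilizes_finite_module:
  fixes x :: "'a :: field_char_0"
  assumes "finite S" "s \<in> S" "s \<noteq> 0" and stab: "\<And>t. t \<in> S \<Longrightarrow> x * t \<in> int_mod.span S"
  shows "algebraic_int x"
proof -
  obtain ss where ss: "set ss = S" "distinct ss" using finite_distinct_list[OF assms(1)] by blast
  define n where "n = length ss"
  have "\<forall>t\<in>S. \<exists>c. x * t = (\<Sum>r\<in>S. of_int (c r) * r)"
    using stab int_mod.span_finite[OF assms(1)] by blast
  then obtain c where c: "\<And>t. t \<in> S \<Longrightarrow> x * t = (\<Sum>r\<in>S. of_int (c t r) * r)" by metis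
  define A :: "int Matrix.mat" where "A = Matrix.mat n n (\<lambda>(i, j). c (ss ! i) (ss ! j))"
  define A' :: "'a Matrix.mat" where "A' = map_mat of_int A"
  define v :: "'a Matrix.vec" where "v = Matrix.vec n (\<lambda>i. ss ! i)"
  have A: "A \<in> carrier_mat n n" and A': "A' \<in> carrier_mat n n" by (auto simp: A_def A'_def)
  have "A' *\<^sub>v v = x \<cdot>\<^sub>v v"
  proof (rule eq_vecI)
    fix i assume "i < dim_vec (x \<cdot>\<^sub>v v)"
    then have i: "i < n" by (simp add: v_def)
    have "vec_index (A' *\<^sub>v v) i = (\<Sum>j<n. of_int (c (ss ! i) (ss ! j)) * ss ! j)"
      using i A' by (simp add: scalar_prod_def v_def A'_def A_def lessThan_atLeast0)
    also have "\<dots> = (\<Sum>r\<in>S. of_int (c (ss ! i) r) * r)"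
      using sum.reindex_bij_betw[OF bij_betw_nth[OF ss(2) refl refl], of "\<lambda>r. of_int (c (ss ! i) r) * r"]
      by (simp add: ss(1) n_def)
    also have "\<dots> = x * ss ! i" using c[of "ss ! i"] i ss(1) by (auto simp: n_def)
    finally show "vec_index (A' *\<^sub>v v) i = vec_index (x \<cdot>\<^sub>v v) i" using i by (simp add: v_def)
  qed (use A' in \<open>auto simp: v_def\<close>)
  moreover have "v \<noteq> 0\<^sub>v n"
  proof
    assume "v = 0\<^sub>v n"
    obtain i where "i < n" "ss ! i = s" using assms(2) ss(1) by (metis in_set_conv_nth n_def)
    then have "vec_index v i = s" by (simp add: v_def)
    with \<open>v = 0\<^sub>v n\<close> \<open>i < n\<close> \<open>s \<noteq> 0\<close> show False by simp
  qed
  ultimately have "eigenvalue A' x"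
    using A' by (auto simp: eigenvalue_def eigenvector_def v_def intro!: exI[of _ v])
  then have "poly (char_poly A') x = 0" using eigenvalue_root_char_poly[OF A'] by simp
  then have "poly (map_poly of_int (char_poly A)) x = 0"
    unfolding A'_def of_int_hom.char_poly_hom[OF A] .
  moreover have "lead_coeff (char_poly A) = 1" using degree_monic_char_poly[OF A] by simp
  ultimately show ?thesis by (auto simp: algebraic_int_altdef_ipoly)
qed

lemma mult_mem_int_span:
  assumes "\<And>t. t \<in> S \<Longrightarrow> x * t \<in> int_mod.span S" and "u \<in> int_mod.span S"
  shows "x * u \<in> int_mod.span S"
  using assms(2)
proof (induction rule: int_mod.span_induct_alt)
  case base
  show ?case by (simp add: int_mod.span_zero)
next
  case (step c t u)
  have "x * (of_int c * t + u) = of_int c * (x * t) + x * u" by (simp add: algebra_simps)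
  with assms(1)[OF step.hyps(1)] step.IH show ?case
    by (simp add: int_mod.span_add int_mod.span_scale)
qed

lemma algebraic_int_power_relation:
  fixes x :: "'a :: field_char_0"
  assumes "algebraic_int x"
  obtains n c where "n > 0" "x ^ n = (\<Sum>i<n. of_int (c i) * x ^ i)"
proof -
  from assms obtain p where p: "poly (map_poly of_int p) x = 0" "lead_coeff p = 1"
    by (auto simp: algebraic_int_altdef_ipoly)
  have "degree p > 0"
  proof (rule ccontr)
    assume "\<not> degree p > 0"
    with p(2) have "p = 1" using monic_degree_0 by blast
    with p(1) show False by simp
  qed
  have "degree (map_poly of_int p :: 'a poly) = degree p" by (rule degree_map_poly) simp
  then have "0 = (\<Sum>i\<le>degree p. of_int (coeff p i) * x ^ i)"
    using p(1) by (simp add: poly_altdef coeff_map_poly)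
  also have "\<dots> = (\<Sum>i<degree p. of_int (coeff p i) * x ^ i) + x ^ degree p"
    using p(2) by (simp flip: lessThan_Suc_atMost)
  finally have "x ^ degree p = - (\<Sum>i<degree p. of_int (coeff p i) * x ^ i)"
    by (metis add_eq_0_iff)
  then have "x ^ degree p = (\<Sum>i<degree p. of_int (- coeff p i) * x ^ i)" by (simp add: sum_negf)
  with \<open>degree p > 0\<close> show ?thesis by (rule that)
qed

text \<open>Multiplication by x raises the first exponent by one, and the relation for
  \<open>x ^ m\<close> brings back the only exponent that leaves the range.\<close>

lemma power_products_stable:
  fixes x y :: "'a :: field_char_0" and m n :: nat
  assumes x: "x ^ m = (\<Sum>i<m. of_int (c i) * x ^ i)"
  defines "S \<equiv> (\<lambda>(i, j). x ^ i * y ^ j) ` ({..<m} \<times> {..<n})"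
  assumes "t \<in> S"
  shows "x * t \<in> int_mod.span S"
proof -
  obtain i j where ij: "t = x ^ i * y ^ j" "i < m" "j < n" using assms(3) by (auto simp: S_def)
  show ?thesis
  proof (cases "Suc i < m")
    case True
    then have "x ^ Suc i * y ^ j \<in> S" using ij(3) unfolding S_def by (intro image_eqI[of _ _ "(Suc i, j)"]) auto
    then show ?thesis using ij(1) int_mod.span_base by (fastforce simp: mult.assoc)
  next
    case False
    then have "Suc i = m" using ij(2) by simp
    then have "x * t = x ^ m * y ^ j" using ij(1) by (auto simp: mult.assoc)
    also have "\<dots> = (\<Sum>k<m. of_int (c k) * (x ^ k * y ^ j))"
      unfolding x by (simp add: sum_distrib_right mult.assoc)
    also have "\<dots> \<in> int_mod.span S"
      using ij(3) unfolding S_def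
      by (intro int_mod.span_sum int_mod.span_scale int_mod.span_base) auto
    finally show ?thesis .
  qed
qed

text \<open>The monomials below the two degrees span a finitely generated module that is stable
  under x and under y, hence under their sum and their product.\<close>

lemma algebraic_int_plus_times:
  fixes x y :: "'a :: field_char_0"
  assumes "algebraic_int x" "algebraic_int y"
  shows "algebraic_int (x + y) \<and> algebraic_int (x * y)"
proof -
  obtain m c where m: "m > 0" "x ^ m = (\<Sum>i<m. of_int (c i) * x ^ i)"
    using algebraic_int_power_relation[OF assms(1)] .
  obtain n d where n: "n > 0" "y ^ n = (\<Sum>i<n. of_int (d i) * y ^ i)"
    using algebraic_int_power_relation[OF assms(2)] .
  define S where "S = (\<lambda>(i, j). x ^ i * y ^ j) ` ({..<m} \<times> {..<n})"
  have S_swap: "S = (\<lambda>(j, i). y ^ j * x ^ i) ` ({..<n} \<times> {..<m})"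
  proof -
    have "{..<m} \<times> {..<n} = prod.swap ` ({..<n} \<times> {..<m})" by (simp add: product_swap)
    then show ?thesis by (simp add: S_def image_image case_prod_unfold mult.commute)
  qed
  have fin: "finite S" by (simp add: S_def)
  have one: "1 \<in> S" using m(1) n(1) unfolding S_def by (intro image_eqI[of _ _ "(0, 0)"]) auto
  have xS: "x * t \<in> int_mod.span S" if "t \<in> S" for t
    using power_products_stable[OF m(2)] that unfolding S_def .
  have yS: "y * t \<in> int_mod.span S" if "t \<in> S" for t
    using power_products_stable[OF n(2)] that unfolding S_swap .
  have "(x + y) * t \<in> int_mod.span S" if "t \<in> S" for t
    using int_mod.span_add[OF xS yS, OF that that] by (simp add: distrib_right)
  moreover have "x * y * t \<in> int_mod.span S" if "t \<in> S" for t
    using mult_mem_int_span[OF xS yS[OF that]] by (simp add: mult.assoc)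
  ultimately show ?thesis
    using algebraic_int_if_stabilizes_finite_module[OF fin one] by auto
qed

lemmas algebraic_int_plus = algebraic_int_plus_times[THEN conjunct1]
lemmas algebraic_int_times = algebraic_int_plus_times[THEN conjunct2]

lemma algebraic_int_diff:
  "algebraic_int x \<Longrightarrow> algebraic_int y \<Longrightarrow> algebraic_int (x - y)" for x y :: "'a :: field_char_0"
  using algebraic_int_plus[of x "- y"] by simp

lemma algebraic_int_of_int: "algebraic_int (of_int k :: 'a :: field_char_0)"
  by (simp add: int_imp_algebraic_int)

lemma algebraic_int_hom:
  fixes \<sigma> :: "'a :: field_char_0 \<Rightarrow> 'b :: field_char_0"
  assumes "field_hom \<sigma>" "algebraic_int x"
  shows "algebraic_int (\<sigma> x)"
proof -
  interpret field_hom \<sigma> by fact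
  obtain p where p: "poly (map_poly of_int p) x = 0" "lead_coeff p = 1"
    using assms(2) by (auto simp: algebraic_int_altdef_ipoly)
  have "poly (map_poly of_int p) (\<sigma> x) = \<sigma> (poly (map_poly of_int p) x)"
    by (simp add: poly_altdef hom_distribs)
  with p show ?thesis by (auto simp: algebraic_int_altdef_ipoly)
qed

lemma of_rat_algebraic_int_imp_Ints:
  assumes "algebraic_int (of_rat q :: 'a :: field_char_0)"
  shows "q \<in> \<int>"
proof -
  have "of_rat q \<in> (\<int> :: 'a set)" by (rule rational_algebraic_int_is_int[OF assms Rats_of_rat])
  then obtain k where "of_rat q = (of_int k :: 'a)" by (rule Ints_cases)
  also have "\<dots> = of_rat (of_int k)" by simp
  finally show ?thesis unfolding of_rat_eq_iff by simp
qed

subsection \<open>Generators of cubic fields\<close>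

lemma card_rat_basis: "card (set (rat_basis :: 'a :: number_field list)) = field_degree TYPE('a)"
  using rat_vs.dim_eq_card[OF _ independent_rat_basis, of "UNIV :: 'a set"] span_rat_basis[where 'a = 'a]
  by (simp add: field_degree_def)

lemma length_rat_basis: "length (rat_basis :: 'a :: number_field list) = field_degree TYPE('a)"
  using distinct_card[OF distinct_rat_basis] card_rat_basis by metis

lemma card_independent_le_field_degree:
  fixes S :: "'a :: number_field set"
  assumes "rat_vs.independent S"
  shows "finite S \<and> card S \<le> field_degree TYPE('a)"
  using rat_vs.independent_span_bound[OF finite_set assms, of rat_basis]
  by (simp add: span_rat_basis card_rat_basis)

lemma field_degree_le_card_spanning:
  fixes S :: "'a :: number_field set"
  assumes "finite S" "rat_vs.span S = UNIV"
  shows "field_degree TYPE('a) \<le> card S"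
  using rat_vs.independent_span_bound[OF assms(1) independent_rat_basis] assms(2)
  by (simp add: card_rat_basis)

lemma span_UNIV_if_card:
  fixes S :: "'a :: number_field set"
  assumes "rat_vs.independent S" "card S = field_degree TYPE('a)"
  shows "rat_vs.span S = UNIV"
proof (rule ccontr)
  assume "rat_vs.span S \<noteq> UNIV"
  then obtain y where y: "y \<notin> rat_vs.span S" by blast
  have fin: "finite S" using card_independent_le_field_degree[OF assms(1)] by blast
  have "y \<notin> S" using y rat_vs.span_base by blast
  have "rat_vs.independent (insert y S)" using y assms(1) by (rule rat_vs.independent_insertI)
  with \<open>y \<notin> S\<close> show False using card_independent_le_field_degree[of "insert y S"] assms(2) fin by simp
qed

lemma mem_rat_span_1: "y \<in> rat_vs.span {1 :: 'a :: number_field} \<longleftrightarrow> (\<exists>p. y = of_rat p)"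
  by (simp add: rat_vs.span_breakdown_eq)

lemma mem_rat_span_2:
  "y \<in> rat_vs.span {x, 1 :: 'a :: number_field} \<longleftrightarrow> (\<exists>p q. y = of_rat p + of_rat q * x)"
  unfolding rat_vs.span_breakdown_eq[of y x] mem_rat_span_1 by (auto simp: algebra_simps)

lemma mem_rat_span_3:
  "y \<in> rat_vs.span {w, x, 1 :: 'a :: number_field} \<longleftrightarrow>
    (\<exists>p q r. y = of_rat p + of_rat q * x + of_rat r * w)"
  unfolding rat_vs.span_breakdown_eq[of y w] mem_rat_span_2
  by (metis (no_types, opaque_lifting) add_diff_cancel_right' diff_add_cancel)

text \<open>That 1, x, x^2 form a rational basis is phrased with explicit coefficients, so that
  relations can be compared coefficient by coefficient without bases as sets.\<close>

definition cubic_generator :: "'a :: number_field \<Rightarrow> bool" where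
  "cubic_generator x \<longleftrightarrow>
     (\<forall>p q r. of_rat p + of_rat q * x + of_rat r * x\<^sup>2 = 0 \<longrightarrow> p = 0 \<and> q = 0 \<and> r = 0) \<and>
     (\<forall>y. \<exists>p q r. y = of_rat p + of_rat q * x + of_rat r * x\<^sup>2)"

lemma cubic_generator_eq_iff:
  assumes "cubic_generator x"
  shows "of_rat p + of_rat q * x + of_rat r * x\<^sup>2 = of_rat p' + of_rat q' * x + of_rat r' * x\<^sup>2
    \<longleftrightarrow> p = p' \<and> q = q' \<and> r = r'"
proof
  assume eq: "of_rat p + of_rat q * x + of_rat r * x\<^sup>2 = of_rat p' + of_rat q' * x + of_rat r' * x\<^sup>2"
  have "of_rat (p - p') + of_rat (q - q') * x + of_rat (r - r') * x\<^sup>2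
    = (of_rat p + of_rat q * x + of_rat r * x\<^sup>2) - (of_rat p' + of_rat q' * x + of_rat r' * x\<^sup>2)"
    by (simp add: of_rat_diff algebra_simps)
  then have "of_rat (p - p') + of_rat (q - q') * x + of_rat (r - r') * x\<^sup>2 = 0"
    unfolding eq by simp
  then have "p - p' = 0 \<and> q - q' = 0 \<and> r - r' = 0"
    using assms unfolding cubic_generator_def by blast
  then show "p = p' \<and> q = q' \<and> r = r'" by simp
qed simp

lemma irrational_independent:
  assumes "x \<notin> \<rat>"
  shows "rat_vs.independent {x, 1 :: 'a :: number_field}"
proof -
  have "x \<notin> rat_vs.span {1}" using assms unfolding mem_rat_span_1 Rats_def by auto
  then show ?thesis by (simp add: rat_vs.independent_insert)
qed

text \<open>If x^2 = t + s x, the other root is s - x, so x + (k - s) is up to sign the conjugate of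
  x - k. Multiplying by it replaces a division by x - k.\<close>

lemma quadratic_conjugate_identities:
  fixes x k s p q t :: "'a :: comm_ring_1"
  shows conjugate_product: "(x + (k - s)) * (x - k) = x\<^sup>2 - s * x - k * (k - s)"
    and conjugate_times_linear: "(x + (k - s)) * (p + q * x) = (k - s) * p + (p + (k - s) * q) * x + q * x\<^sup>2"
    and linear_mod_quadratic: "(k - s) * p + (p + (k - s) * q) * x + q * (t + s * x) = ((k - s) * p + q * t) + (p + (k - s) * q + q * s) * x"
  by (simp_all add: power2_eq_square algebra_simps)

text \<open>This is the tower law for a quadratic subfield, done by hand. If 1 and x spanned a
  field, then for y outside of it the elements 1, x, y, x y would be independent, four of them in a
  space of dimension three.\<close>

lemma square_not_in_span:
  fixes x :: "'a :: number_field"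
  assumes deg: "field_degree TYPE('a) = 3" and x: "x \<notin> \<rat>"
  shows "x\<^sup>2 \<notin> rat_vs.span {x, 1}"
proof
  assume "x\<^sup>2 \<in> rat_vs.span {x, 1}"
  then obtain t s where sq: "x\<^sup>2 = of_rat t + of_rat s * x" unfolding mem_rat_span_2 by blast
  have "card {x, 1} \<le> 2" by (simp add: card_insert_if)
  with deg have "rat_vs.span {x, 1} \<noteq> UNIV"
    using field_degree_le_card_spanning[of "{x, 1}"] by auto
  then obtain y where y: "y \<notin> rat_vs.span {x, 1}" by blast
  have "x * y \<notin> rat_vs.span {y, x, 1}"
  proof
    assume "x * y \<in> rat_vs.span {y, x, 1}"
    then obtain p q k where "x * y = of_rat p + of_rat q * x + of_rat k * y"
      unfolding mem_rat_span_3 by blast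
    then have "(x - of_rat k) * y = of_rat p + of_rat q * x" by (simp add: algebra_simps)
    \<comment> \<open>After multiplication by the conjugate, the coefficient of y is the rational
      number \<open>t - k * (k - s)\<close>. It is nonzero because x is irrational, so y would lie
      in the span of x and 1.\<close>
    then have "(x + of_rat (k - s)) * (x - of_rat k) * y = (x + of_rat (k - s)) * (of_rat p + of_rat q * x)"
      by (simp add: mult.assoc)
    moreover have fac: "(x + of_rat (k - s)) * (x - of_rat k) = of_rat (t - k * (k - s))"
    proof -
      have "(x + of_rat (k - s)) * (x - of_rat k) = x\<^sup>2 - of_rat s * x - of_rat (k * (k - s))"
        unfolding of_rat_diff of_rat_mult by (rule conjugate_product)
      then show ?thesis by (simp add: sq of_rat_diff)
    qed
    moreover have "(x + of_rat (k - s)) * (of_rat p + of_rat q * x)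
        = of_rat ((k - s) * p + q * t) + of_rat (p + (k - s) * q + q * s) * x"
    proof -
      have "(x + of_rat (k - s)) * (of_rat p + of_rat q * x)
          = of_rat ((k - s) * p) + of_rat (p + (k - s) * q) * x + of_rat q * x\<^sup>2"
        unfolding of_rat_diff of_rat_mult of_rat_add by (rule conjugate_times_linear)
      then show ?thesis
        unfolding sq of_rat_diff of_rat_mult of_rat_add by (rule trans[OF _ linear_mod_quadratic])
    qed
    ultimately have eq: "of_rat (t - k * (k - s)) * y
      = of_rat ((k - s) * p + q * t) + of_rat (p + (k - s) * q + q * s) * x"
      by simp
    have "t - k * (k - s) \<noteq> 0"
    proof
      assume "t - k * (k - s) = 0"
      with fac have "(x + of_rat (k - s)) * (x - of_rat k) = 0" by simp
      then have "x = - of_rat (k - s) \<or> x = of_rat k"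
        unfolding mult_eq_0_iff by (simp add: eq_neg_iff_add_eq_0)
      with x show False by auto
    qed
    moreover define c A B where "c = t - k * (k - s)" and "A = (k - s) * p + q * t" and "B = p + (k - s) * q + q * s"
    ultimately have "c \<noteq> 0" and eq: "of_rat c * y = of_rat A + of_rat B * x" using eq by simp_all
    from \<open>c \<noteq> 0\<close> have "y = of_rat c * y / of_rat c" by simp
    also have "\<dots> = of_rat (A / c) + of_rat (B / c) * x"
      unfolding eq of_rat_divide add_divide_distrib by simp
    finally have "y = of_rat (A / c) + of_rat (B / c) * x" .
    with y show False unfolding mem_rat_span_2 by blast
  qed
  moreover have "rat_vs.independent {y, x, 1}"
    using y irrational_independent[OF x] by (rule rat_vs.independent_insertI)
  ultimately have ind: "rat_vs.independent {x * y, y, x, 1}" by (rule rat_vs.independent_insertI)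
  have "x \<noteq> 1" using x by auto
  moreover have "y \<notin> {x, 1}" using y rat_vs.span_base[of y "{x, 1}"] by blast
  moreover have "x * y \<notin> {y, x, 1}" using \<open>x * y \<notin> rat_vs.span {y, x, 1}\<close> rat_vs.span_base[of "x * y" "{y, x, 1}"] by blast
  ultimately have "card {x * y, y, x, 1} = 4" by simp
  with card_independent_le_field_degree[OF ind] deg show False by simp
qed

lemma cubic_generator_if_irrational:
  fixes x :: "'a :: number_field"
  assumes deg: "field_degree TYPE('a) = 3" and x: "x \<notin> \<rat>"
  shows "cubic_generator x"
proof -
  have ind: "rat_vs.independent {x\<^sup>2, x, 1}"
    using square_not_in_span[OF assms] irrational_independent[OF x] by (rule rat_vs.independent_insertI)
  have ne: "x \<noteq> 1" "x\<^sup>2 \<notin> {x, 1}"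
    using x square_not_in_span[OF assms] rat_vs.span_base[of "x\<^sup>2" "{x, 1}"] by auto
  then have "card {x\<^sup>2, x, 1} = field_degree TYPE('a)" using deg by simp
  then have "rat_vs.span {x\<^sup>2, x, 1} = UNIV" using span_UNIV_if_card[OF ind] by blast
  then have span: "\<exists>p q r. y = of_rat p + of_rat q * x + of_rat r * x\<^sup>2" for y
    unfolding mem_rat_span_3[symmetric] by simp
  have "p = 0 \<and> q = 0 \<and> r = 0" if 0: "of_rat p + of_rat q * x + of_rat r * x\<^sup>2 = 0" for p q r
  proof -
    have "r = 0"
    proof (rule ccontr)
      assume "r \<noteq> 0"
      have "of_rat r * x\<^sup>2 = - of_rat p - of_rat q * x" using 0 by (simp add: eq_neg_iff_add_eq_0 algebra_simps)
      then have "x\<^sup>2 = of_rat (- p / r) + of_rat (- q / r) * x"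
        using \<open>r \<noteq> 0\<close> by (simp add: of_rat_divide of_rat_minus field_simps)
      then show False using square_not_in_span[OF assms] unfolding mem_rat_span_2 by blast
    qed
    moreover have "q = 0"
    proof (rule ccontr)
      assume "q \<noteq> 0"
      have "of_rat q * x = - of_rat p" using 0 \<open>r = 0\<close> by (simp add: eq_neg_iff_add_eq_0 algebra_simps)
      then have "x = of_rat (- p / q)"
        using \<open>q \<noteq> 0\<close> by (simp add: of_rat_divide of_rat_minus field_simps)
      with x show False by auto
    qed
    ultimately show ?thesis using 0 by simp
  qed
  with span show ?thesis unfolding cubic_generator_def by blast
qed

lemma ex_irrational:
  assumes "field_degree TYPE('a :: number_field) = 3"
  shows "\<exists>x :: 'a. x \<notin> \<rat>"
proof (rule ccontr)
  assume "\<nexists>x :: 'a. x \<notin> \<rat>"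
  then have "y \<in> rat_vs.span {1 :: 'a}" for y by (auto simp: mem_rat_span_1 elim: Rats_cases)
  then have "rat_vs.span {1 :: 'a} = UNIV" by blast
  then have "field_degree TYPE('a) \<le> card {1 :: 'a}" by (intro field_degree_le_card_spanning) simp_all
  with assms show False by simp
qed

lemma ex_denominator: "\<exists>d m :: int. d > 0 \<and> of_int d * (u :: rat) = of_int m"
proof -
  obtain m d where q: "quotient_of u = (m, d)" by (cases "quotient_of u")
  have "d > 0" using q by (rule quotient_of_denom_pos)
  moreover have "of_int d * u = of_int m" using quotient_of_div[OF q] \<open>d > 0\<close> by simp
  ultimately show ?thesis by blast
qed

text \<open>Scaling x by a common denominator N of the coefficients p, q, r of x^3 turns them into
  N^3 p, N^2 q, N r, which are integers.\<close>

lemma ex_integral_cubic_generator: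
  assumes "field_degree TYPE('a :: number_field) = 3"
  shows "\<exists>(x :: 'a) e0 e1 e2 :: int. cubic_generator x
    \<and> x ^ 3 = of_int e0 + of_int e1 * x + of_int e2 * x\<^sup>2"
proof -
  obtain x :: 'a where x: "x \<notin> \<rat>" using ex_irrational[OF assms] by blast
  obtain p q r where rel: "x ^ 3 = of_rat p + of_rat q * x + of_rat r * x\<^sup>2"
    using cubic_generator_if_irrational[OF assms x] unfolding cubic_generator_def by blast
  obtain dp dq dr mp mq mr :: int where d: "dp > 0" "dq > 0" "dr > 0"
    and m: "of_int dp * p = of_int mp" "of_int dq * q = of_int mq" "of_int dr * r = of_int mr"
    using ex_denominator[of p] ex_denominator[of q] ex_denominator[of r] by blast
  define N where "N = dp * dq * dr"
  define np nq nr where "np = mp * (dq * dr)" and "nq = mq * (dp * dr)" and "nr = mr * (dp * dq)"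
  have "of_int N * p = (of_int dp * p) * of_int (dq * dr)" "of_int N * q = (of_int dq * q) * of_int (dp * dr)"
    "of_int N * r = (of_int dr * r) * of_int (dp * dq)"
    by (simp_all add: N_def)
  then have n: "of_int N * p = of_int np" "of_int N * q = of_int nq" "of_int N * r = of_int nr"
    unfolding m by (simp_all add: np_def nq_def nr_def)
  have N: "of_int N * of_rat p = (of_int np :: 'a)" "of_int N * of_rat q = (of_int nq :: 'a)"
    "of_int N * of_rat r = (of_int nr :: 'a)"
    using n[THEN arg_cong[of _ _ "of_rat :: rat \<Rightarrow> 'a"]] unfolding of_rat_mult of_rat_of_int_eq .
  let ?y = "of_int N * x"
  have "N > 0" using d by (simp add: N_def)
  have "?y \<notin> \<rat>"
  proof
    assume "?y \<in> \<rat>"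
    then have "?y / of_int N \<in> \<rat>" by (intro Rats_divide) simp_all
    with x \<open>N > 0\<close> show False by simp
  qed
  then have gen: "cubic_generator ?y" by (rule cubic_generator_if_irrational[OF assms])
  have ring_id: "n ^ 3 * (a + b * z + c * z\<^sup>2) = n ^ 2 * (n * a) + n * (n * b) * (n * z) + n * c * (n\<^sup>2 * z\<^sup>2)"
    for n a b c z :: 'a
    by (simp add: power2_eq_square power3_eq_cube algebra_simps)
  have "?y ^ 3 = of_int N ^ 2 * (of_int N * of_rat p) + of_int N * (of_int N * of_rat q) * ?y
      + (of_int N * of_rat r) * ?y\<^sup>2"
    unfolding power_mult_distrib rel
    by (rule ring_id[of "of_int N" "of_rat p" "of_rat q" x "of_rat r"])
  then have "?y ^ 3 = of_int (N\<^sup>2 * np) + of_int (N * nq) * ?y + of_int nr * ?y\<^sup>2"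
    unfolding N by simp
  with gen show ?thesis by blast
qed

subsection \<open>Embeddings and the norm\<close>

lemma field_hom_of_rat:
  fixes \<sigma> :: "'a :: field_char_0 \<Rightarrow> 'b :: field_char_0"
  assumes "field_hom \<sigma>"
  shows "\<sigma> (of_rat q) = of_rat q"
proof -
  interpret field_hom \<sigma> by fact
  obtain a b where q: "quotient_of q = (a, b)" by (cases "quotient_of q")
  have "q = of_int a / of_int b" using quotient_of_div[OF q] .
  then show ?thesis by (simp add: of_rat_divide hom_distribs)
qed

lemma field_hom_quadratic:
  fixes \<sigma> :: "'a :: field_char_0 \<Rightarrow> 'b :: field_char_0"
  assumes "field_hom \<sigma>"
  shows "\<sigma> (of_rat p + of_rat q * x + of_rat r * x\<^sup>2) = of_rat p + of_rat q * \<sigma> x + of_rat r * (\<sigma> x)\<^sup>2"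
proof -
  interpret field_hom \<sigma> by fact
  show ?thesis by (simp add: hom_distribs field_hom_of_rat[OF assms])
qed

text \<open>Stated over any commutative ring because the same multiplication table is used in the
  field, at x, and in the target of an embedding, at the image of x.\<close>

lemma quadratic_mult_mod_cubic:
  fixes x :: "'b :: comm_ring_1"
  assumes "x ^ 3 = c0 + c1 * x + c2 * x\<^sup>2"
  shows "(p + q * x + r * x\<^sup>2) * (p' + q' * x + r' * x\<^sup>2)
    = (p * p' + (q * r' + r * q') * c0 + r * r' * (c2 * c0))
      + (p * q' + q * p' + (q * r' + r * q') * c1 + r * r' * (c0 + c2 * c1)) * x
      + (p * r' + q * q' + r * p' + (q * r' + r * q') * c2 + r * r' * (c1 + c2 * c2)) * x\<^sup>2"
proof -
  have x4: "x ^ 4 = c2 * c0 + (c0 + c2 * c1) * x + (c1 + c2 * c2) * x\<^sup>2"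
  proof -
    have "x ^ 4 = x * x ^ 3" by (simp add: numeral_eq_Suc)
    also have "\<dots> = x * (c0 + c1 * x + c2 * x\<^sup>2)" unfolding assms ..
    also have "\<dots> = c0 * x + c1 * x\<^sup>2 + c2 * x ^ 3"
      by (simp add: algebra_simps power2_eq_square power3_eq_cube)
    also have "\<dots> = c2 * c0 + (c0 + c2 * c1) * x + (c1 + c2 * c2) * x\<^sup>2"
      unfolding assms by (simp add: algebra_simps)
    finally show ?thesis .
  qed
  have "x ^ 4 = x * x * (x * x)" by (simp add: numeral_eq_Suc mult.assoc)
  then have "(p + q * x + r * x\<^sup>2) * (p' + q' * x + r' * x\<^sup>2)
    = p * p' + (p * q' + q * p') * x + (p * r' + q * q' + r * p') * x\<^sup>2 + (q * r' + r * q') * x ^ 3 + r * r' * x ^ 4"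
    by (simp add: algebra_simps power2_eq_square power3_eq_cube)
  then show ?thesis unfolding x4 assms by (simp add: algebra_simps)
qed

text \<open>The embedding is evaluation of rational quadratics in x at z. It respects products
  because x and z obey the same cubic relation, so both sides reduce to the same
  coordinates.\<close>

lemma ex_embedding_at_root:
  fixes x :: "'a :: number_field" and z :: "'b :: field_char_0"
  assumes gen: "cubic_generator x"
    and x: "x ^ 3 = of_rat c0 + of_rat c1 * x + of_rat c2 * x\<^sup>2"
    and z: "z ^ 3 = of_rat c0 + of_rat c1 * z + of_rat c2 * z\<^sup>2"
  shows "\<exists>\<sigma> :: 'a \<Rightarrow> 'b. field_hom \<sigma> \<and> \<sigma> x = z"
proof -
  have "\<forall>y. \<exists>p q r. y = of_rat p + of_rat q * x + of_rat r * x\<^sup>2"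
    using gen by (simp add: cubic_generator_def)
  then obtain P Q R where PQR: "\<And>y. y = of_rat (P y) + of_rat (Q y) * x + of_rat (R y) * x\<^sup>2"
    by metis
  define \<sigma> :: "'a \<Rightarrow> 'b" where "\<sigma> y = of_rat (P y) + of_rat (Q y) * z + of_rat (R y) * z\<^sup>2" for y
  have \<sigma>: "\<sigma> y = of_rat p + of_rat q * z + of_rat r * z\<^sup>2"
    if "y = of_rat p + of_rat q * x + of_rat r * x\<^sup>2" for y p q r
  proof -
    have "of_rat (P y) + of_rat (Q y) * x + of_rat (R y) * x\<^sup>2 = of_rat p + of_rat q * x + of_rat r * x\<^sup>2"
      using PQR[of y] that by simp
    then have "P y = p \<and> Q y = q \<and> R y = r" unfolding cubic_generator_eq_iff[OF gen] .
    then show ?thesis by (simp add: \<sigma>_def)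
  qed
  have "\<sigma> (y + w) = \<sigma> y + \<sigma> w" for y w
  proof -
    have "y + w = of_rat (P y + P w) + of_rat (Q y + Q w) * x + of_rat (R y + R w) * x\<^sup>2"
      by (subst PQR[of y], subst PQR[of w]) (simp add: of_rat_add distrib_right)
    from \<sigma>[OF this] show ?thesis by (simp add: \<sigma>_def of_rat_add distrib_right)
  qed
  moreover have "\<sigma> (y * w) = \<sigma> y * \<sigma> w" for y w
  proof -
    define p q r p' q' r' where "p = P y" "q = Q y" "r = R y" "p' = P w" "q' = Q w" "r' = R w"
    note pqr = this
    have y: "y = of_rat p + of_rat q * x + of_rat r * x\<^sup>2" and w: "w = of_rat p' + of_rat q' * x + of_rat r' * x\<^sup>2"
      unfolding pqr by (rule PQR)+
    have "y * w = of_rat (p * p' + (q * r' + r * q') * c0 + r * r' * (c2 * c0))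
      + of_rat (p * q' + q * p' + (q * r' + r * q') * c1 + r * r' * (c0 + c2 * c1)) * x
      + of_rat (p * r' + q * q' + r * p' + (q * r' + r * q') * c2 + r * r' * (c1 + c2 * c2)) * x\<^sup>2"
      unfolding y w of_rat_add of_rat_mult by (rule quadratic_mult_mod_cubic[OF x])
    from \<sigma>[OF this] show ?thesis
      unfolding \<sigma>[OF y] \<sigma>[OF w] quadratic_mult_mod_cubic[OF z] of_rat_add of_rat_mult .
  qed
  moreover have "\<sigma> 0 = 0" using \<sigma>[of 0 0 0 0] by simp
  moreover have "\<sigma> 1 = 1" using \<sigma>[of 1 1 0 0] by simp
  ultimately have "field_hom \<sigma>" by unfold_locales
  moreover have "\<sigma> x = z" using \<sigma>[of x 0 1 0] by simp
  ultimately show ?thesis by blast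
qed

lemma complex_cubic_roots:
  fixes c0 c1 c2 :: complex
  shows "\<exists>u v w. c2 = u + v + w \<and> c1 = - (u * v + v * w + u * w) \<and> c0 = u * v * w"
proof -
  have "\<not> constant (poly [:- c0, - c1, - c2, 1:])" by (simp add: constant_degree)
  then obtain u where "poly [:- c0, - c1, - c2, 1:] u = 0" using fundamental_theorem_of_algebra by blast
  then have u: "c0 = u ^ 3 - c2 * u ^ 2 - c1 * u"
    by (simp add: algebra_simps power2_eq_square power3_eq_cube add_eq_0_iff)
  \<comment> \<open>Splitting off the root u leaves the quadratic z^2 - (c2 - u) z - (u (c2 - u) +
    c1); \<open>d\<close> is a square root of its discriminant.\<close>
  define d where "d = csqrt ((c2 - u)\<^sup>2 + 4 * (u * (c2 - u) + c1))"
  define v where "v = ((c2 - u) + d) / 2"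
  define w where "w = ((c2 - u) - d) / 2"
  have vw: "v + w = c2 - u" by (simp add: v_def w_def field_simps)
  have "v * w = ((c2 - u)\<^sup>2 - d\<^sup>2) / 4" by (simp add: v_def w_def field_simps power2_eq_square)
  also have "\<dots> = - (u * (c2 - u) + c1)" by (simp add: d_def field_simps)
  finally have vw': "v * w = - (u * (c2 - u) + c1)" .
  have "c2 = u + v + w" using vw by (simp add: algebra_simps)
  moreover have "c1 = - (u * (v + w) + v * w)" unfolding vw vw' by simp
  moreover have "c0 = u * (v * w)" unfolding vw' u by (simp add: algebra_simps power2_eq_square power3_eq_cube)
  ultimately show ?thesis by (intro exI[of _ u] exI[of _ v] exI[of _ w]) (simp add: algebra_simps)
qed

text \<open>At a double root the derivative 3 z^2 - 2 c2 z - c1 vanishes too. By injectivity of the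
  embedding this would be a rational quadratic relation for x, with leading coefficient 3.\<close>

lemma cubic_root_simple:
  fixes x :: "'a :: number_field" and \<sigma> :: "'a \<Rightarrow> complex"
  assumes gen: "cubic_generator x" and hom: "field_hom \<sigma>"
    and c: "of_rat c2 = \<sigma> x + v + w" "of_rat c1 = - (\<sigma> x * v + v * w + \<sigma> x * w)"
  shows "\<sigma> x \<noteq> v"
proof
  assume v: "\<sigma> x = v"
  interpret field_hom \<sigma> by fact
  have "\<sigma> (of_rat (- c1) + of_rat (- 2 * c2) * x + of_rat 3 * x\<^sup>2)
      = - of_rat c1 - 2 * of_rat c2 * v + 3 * v\<^sup>2"
    unfolding field_hom_quadratic[OF hom] v by (simp add: of_rat_minus of_rat_mult)
  also have "\<dots> = 0" unfolding c v by (simp add: algebra_simps power2_eq_square)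
  finally have "of_rat (- c1) + of_rat (- 2 * c2) * x + of_rat 3 * x\<^sup>2 = 0" by simp
  then have "(3 :: rat) = 0" using gen unfolding cubic_generator_def by blast
  then show False by simp
qed

lemma field_hom_Re:
  fixes \<sigma> :: "'a :: field \<Rightarrow> complex"
  assumes "field_hom \<sigma>" "range \<sigma> \<subseteq> \<real>"
  shows "field_hom (\<lambda>x. Re (\<sigma> x))"
proof -
  interpret field_hom \<sigma> by fact
  have "Im (\<sigma> x) = 0" for x using assms(2) by (auto simp: complex_is_Real_iff image_subset_iff)
  then show ?thesis by unfold_locales (simp_all add: hom_distribs)
qed

text \<open>Each complex root of the cubic relation gives an embedding. Here total reality enters:
  the roots are real, and the embeddings agree with their real parts.\<close>

lemma ex_real_embeddings:
  fixes x :: "'a :: number_field"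
  assumes gen: "cubic_generator x" and real: "totally_real TYPE('a)"
    and x: "x ^ 3 = of_rat c0 + of_rat c1 * x + of_rat c2 * x\<^sup>2"
  shows "\<exists>\<sigma>1 \<sigma>2 \<sigma>3 :: 'a \<Rightarrow> real. field_hom \<sigma>1 \<and> field_hom \<sigma>2 \<and> field_hom \<sigma>3
    \<and> \<sigma>1 x \<noteq> \<sigma>2 x \<and> \<sigma>2 x \<noteq> \<sigma>3 x \<and> \<sigma>1 x \<noteq> \<sigma>3 x
    \<and> of_rat c2 = \<sigma>1 x + \<sigma>2 x + \<sigma>3 x \<and> of_rat c1 = - (\<sigma>1 x * \<sigma>2 x + \<sigma>2 x * \<sigma>3 x + \<sigma>1 x * \<sigma>3 x)
    \<and> of_rat c0 = \<sigma>1 x * \<sigma>2 x * \<sigma>3 x"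
proof -
  obtain u v w :: complex where c: "of_rat c2 = u + v + w" "of_rat c1 = - (u * v + v * w + u * w)"
    "of_rat c0 = u * v * w"
    using complex_cubic_roots by blast
  have root: "z ^ 3 = of_rat c0 + of_rat c1 * z + of_rat c2 * z\<^sup>2" if "(z - u) * (z - v) * (z - w) = 0" for z :: complex
    using that unfolding c by (simp add: algebra_simps power2_eq_square power3_eq_cube add_eq_0_iff)
  have "(u - u) * (u - v) * (u - w) = 0" "(v - u) * (v - v) * (v - w) = 0" "(w - u) * (w - v) * (w - w) = 0"
    by simp_all
  note roots = this[THEN root]
  obtain \<sigma>1 :: "'a \<Rightarrow> complex" where s1: "field_hom \<sigma>1" "\<sigma>1 x = u"
    using ex_embedding_at_root[OF gen x roots(1)] by blast
  obtain \<sigma>2 :: "'a \<Rightarrow> complex" where s2: "field_hom \<sigma>2" "\<sigma>2 x = v"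
    using ex_embedding_at_root[OF gen x roots(2)] by blast
  obtain \<sigma>3 :: "'a \<Rightarrow> complex" where s3: "field_hom \<sigma>3" "\<sigma>3 x = w"
    using ex_embedding_at_root[OF gen x roots(3)] by blast
  have "\<sigma>1 x \<noteq> v" using cubic_root_simple[OF gen s1(1), of c2 v w c1] c s1(2) by simp
  moreover have "\<sigma>2 x \<noteq> w" using cubic_root_simple[OF gen s2(1), of c2 w u c1] c s2(2) by (simp add: algebra_simps)
  moreover have "\<sigma>1 x \<noteq> w" using cubic_root_simple[OF gen s1(1), of c2 w v c1] c s1(2) by (simp add: algebra_simps)
  ultimately have ne: "u \<noteq> v" "v \<noteq> w" "u \<noteq> w" using s1(2) s2(2) by auto
  have range: "range \<sigma>1 \<subseteq> \<real>" "range \<sigma>2 \<subseteq> \<real>" "range \<sigma>3 \<subseteq> \<real>"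
    using real s1(1) s2(1) s3(1) unfolding totally_real_def by blast+
  have "u \<in> \<real>" "v \<in> \<real>" "w \<in> \<real>" using range s1(2) s2(2) s3(2) by auto
  then obtain u' v' w' where uvw: "u = complex_of_real u'" "v = complex_of_real v'" "w = complex_of_real w'"
    unfolding Reals_def by auto
  have of_rat: "(of_rat q :: complex) = complex_of_real (of_rat q)" for q
    by (simp add: of_rat.rep_eq)
  have c': "of_rat c2 = u' + v' + w'" "of_rat c1 = - (u' * v' + v' * w' + u' * w')" "of_rat c0 = u' * v' * w'"
    using c unfolding of_rat uvw by (simp_all only: of_real_add[symmetric] of_real_mult[symmetric] of_real_minus[symmetric] of_real_eq_iff)
  note homs = field_hom_Re[OF s1(1) range(1)] field_hom_Re[OF s2(1) range(2)] field_hom_Re[OF s3(1) range(3)]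
  show ?thesis
    by (rule exI[of _ "\<lambda>x. Re (\<sigma>1 x)"], rule exI[of _ "\<lambda>x. Re (\<sigma>2 x)"], rule exI[of _ "\<lambda>x. Re (\<sigma>3 x)"])
      (use homs ne c' s1(2) s2(2) s3(2) uvw in simp)
qed

section \<open>The norm as the product of the conjugates\<close>

lemma rat_basis_expansion:
  fixes y :: "'a :: number_field"
  shows "y = (\<Sum>k<length (rat_basis :: 'a list).
    of_rat (rat_vs.representation (set rat_basis) y (rat_basis ! k)) * rat_basis ! k)"
proof -
  have "y = (\<Sum>b\<in>set rat_basis. of_rat (rat_vs.representation (set rat_basis) y b) * b)"
    using rat_vs.sum_representation_eq[OF independent_rat_basis, of y "set rat_basis"]
    by (simp add: span_rat_basis)
  also have "\<dots> = (\<Sum>k<length (rat_basis :: 'a list).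
      of_rat (rat_vs.representation (set rat_basis) y (rat_basis ! k)) * rat_basis ! k)"
    by (rule sum.reindex_bij_betw[OF bij_betw_nth[OF distinct_rat_basis refl refl], symmetric])
  finally show ?thesis .
qed

lemma vandermonde_3_kernel:
  fixes a b c u v w :: real
  assumes "u + v + w = 0" "u * a + v * b + w * c = 0" "u * a\<^sup>2 + v * b\<^sup>2 + w * c\<^sup>2 = 0"
    and ne: "a \<noteq> b" "b \<noteq> c" "a \<noteq> c"
  shows "u = 0 \<and> v = 0 \<and> w = 0"
proof -
  \<comment> \<open>Weighting the values of the polynomial (z - a) (z - b) removes the first two
    points and isolates w.\<close>
  have "w * ((c - a) * (c - b)) = (u * a\<^sup>2 + v * b\<^sup>2 + w * c\<^sup>2) - (a + b) * (u * a + v * b + w * c) + a * b * (u + v + w)"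
    by (simp add: algebra_simps power2_eq_square)
  then have w: "w = 0" unfolding assms(1-3) using ne by simp
  have "v * (b - a) = (u * a + v * b + w * c) - a * (u + v + w) - w * (c - a)" by (simp add: algebra_simps)
  then have "v = 0" unfolding assms(1-3) using ne w by simp
  with w assms(1) show ?thesis by simp
qed

text \<open>With M the matrix of multiplication by x, S the embeddings evaluated on the basis and D
  the diagonal matrix of conjugates of x, one has S M = D S. It remains to see that S is invertible.
  A vector in the kernel of its transpose is a linear relation between the embeddings on the basis,
  hence on the whole field; evaluated at 1, w, w^2 it is a Vandermonde system, as w separates the
  embeddings.\<close>

lemma field_norm_eq_prod_embeddings:
  fixes x w :: "'a :: number_field" and \<sigma>1 \<sigma>2 \<sigma>3 :: "'a \<Rightarrow> real"
  assumes deg: "field_degree TYPE('a) = 3"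
    and hom: "field_hom \<sigma>1" "field_hom \<sigma>2" "field_hom \<sigma>3"
    and ne: "\<sigma>1 w \<noteq> \<sigma>2 w" "\<sigma>2 w \<noteq> \<sigma>3 w" "\<sigma>1 w \<noteq> \<sigma>3 w"
  shows "of_rat (field_norm x) = \<sigma>1 x * \<sigma>2 x * \<sigma>3 x"
proof -
  define bs where "bs = (rat_basis :: 'a list)"
  have len: "length bs = 3" using deg length_rat_basis[where 'a = 'a] by (simp add: bs_def)
  define rep where "rep y k = rat_vs.representation (set bs) y (bs ! k)" for y k
  have expand: "y = (\<Sum>k<3. of_rat (rep y k) * bs ! k)" for y
    using rat_basis_expansion[of y] len by (simp add: bs_def rep_def)
  define s where "s i = (if i = 0 then \<sigma>1 else if i = Suc 0 then \<sigma>2 else \<sigma>3)" for i :: nat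
  have s_hom: "field_hom (s i)" for i using hom by (simp add: s_def)
  have s_expand: "s i y = (\<Sum>k<3. of_rat (rep y k) * s i (bs ! k))" for i y
  proof -
    interpret field_hom "s i" by (rule s_hom)
    show ?thesis by (subst expand[of y]) (simp add: hom_distribs field_hom_of_rat[OF s_hom])
  qed
  define M where "M = Matrix.mat 3 3 (\<lambda>(i, j). real_of_rat (rep (x * bs ! j) i))"
  define S where "S = Matrix.mat 3 3 (\<lambda>(i, j). s i (bs ! j))"
  define D where "D = Matrix.mat 3 3 (\<lambda>(i, j). if i = j then s i x else 0)"
  have carrier: "M \<in> carrier_mat 3 3" "S \<in> carrier_mat 3 3" "D \<in> carrier_mat 3 3"
    by (simp_all add: M_def S_def D_def)
  have "field_norm x = Determinant.det (Matrix.mat 3 3 (\<lambda>(i, j). rep (x * bs ! j) i))"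
    using len by (simp add: field_norm_def Let_def bs_def rep_def)
  then have "of_rat (field_norm x) = Determinant.det (map_mat real_of_rat (Matrix.mat 3 3 (\<lambda>(i, j). rep (x * bs ! j) i)))"
    by (simp only: of_rat_hom.hom_det)
  also have "map_mat real_of_rat (Matrix.mat 3 3 (\<lambda>(i, j). rep (x * bs ! j) i)) = M"
    unfolding M_def by (rule eq_matI) auto
  finally have norm: "of_rat (field_norm x) = Determinant.det M" .
  have "S * M = D * S"
  proof (rule eq_matI)
    fix i j assume "i < dim_row (D * S)" "j < dim_col (D * S)"
    then have ij: "i < 3" "j < 3" using carrier by auto
    interpret field_hom "s i" by (rule s_hom)
    have "(S * M) $$ (i, j) = (\<Sum>k<3. s i (bs ! k) * of_rat (rep (x * bs ! j) k))"
      using ij by (simp add: S_def M_def scalar_prod_def lessThan_atLeast0)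
    also have "\<dots> = s i (x * bs ! j)" by (subst (2) s_expand) (simp add: mult.commute)
    also have "\<dots> = s i x * s i (bs ! j)" by (rule hom_mult)
    also have "\<dots> = (\<Sum>k<3. (if i = k then s i x else 0) * s k (bs ! j))"
      using ij by (subst sum.mono_neutral_cong_right[of "{..<3}" "{i}"]) auto
    also have "\<dots> = (D * S) $$ (i, j)"
      using ij by (simp add: S_def D_def scalar_prod_def lessThan_atLeast0)
    finally show "(S * M) $$ (i, j) = (D * S) $$ (i, j)" .
  qed (use carrier in auto)
  then have "Determinant.det S * Determinant.det M = Determinant.det D * Determinant.det S"
    unfolding det_mult[OF carrier(2,1), symmetric] det_mult[OF carrier(3,2), symmetric] by simp
  moreover have "Determinant.det S \<noteq> 0"
  proof
    assume "Determinant.det S = 0"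
    then have "Determinant.det (S\<^sup>T) = 0" using det_transpose[OF carrier(2)] by simp
    then obtain v where v: "v \<in> carrier_vec 3" "v \<noteq> 0\<^sub>v 3" "S\<^sup>T *\<^sub>v v = 0\<^sub>v 3"
      using det_0_iff_vec_prod_zero[of "S\<^sup>T" 3] carrier(2) by auto
    have "(\<Sum>i<3. s i (bs ! j) * vec_index v i) = 0" if "j < 3" for j
    proof -
      have "(\<Sum>i<3. s i (bs ! j) * vec_index v i) = vec_index (S\<^sup>T *\<^sub>v v) j"
        using that v(1) by (simp add: S_def scalar_prod_def lessThan_atLeast0)
      then show ?thesis using that by (simp add: v(3))
    qed
    note bs_kernel = this
    have "(\<Sum>i<3. s i y * vec_index v i) = 0" for y
    proof -
      have "(\<Sum>i<3. s i y * vec_index v i) = (\<Sum>i<3. \<Sum>k<3. of_rat (rep y k) * (s i (bs ! k) * vec_index v i))"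
        by (subst s_expand) (simp add: sum_distrib_right mult.assoc)
      also have "\<dots> = (\<Sum>k<3. of_rat (rep y k) * (\<Sum>i<3. s i (bs ! k) * vec_index v i))"
        by (subst sum.swap) (simp add: sum_distrib_left)
      also have "\<dots> = 0" using bs_kernel by simp
      finally show ?thesis .
    qed
    then have kernel: "\<sigma>1 y * vec_index v 0 + \<sigma>2 y * vec_index v 1 + \<sigma>3 y * vec_index v 2 = 0" for y
      by (simp add: s_def numeral_3_eq_3 numeral_2_eq_2)
    interpret h1: field_hom \<sigma>1 by fact
    interpret h2: field_hom \<sigma>2 by fact
    interpret h3: field_hom \<sigma>3 by fact
    have "vec_index v 0 = 0 \<and> vec_index v 1 = 0 \<and> vec_index v 2 = 0"
      using kernel[of 1] kernel[of w] kernel[of "w\<^sup>2"] ne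
      by (intro vandermonde_3_kernel[of _ _ _ "\<sigma>1 w" "\<sigma>2 w" "\<sigma>3 w"])
        (simp_all add: h1.hom_power h2.hom_power h3.hom_power mult.commute)
    then have "vec_index v i = 0" if "i < 3" for i
      using that by (auto simp: numeral_3_eq_3 numeral_2_eq_2 less_Suc_eq)
    then have "v = 0\<^sub>v 3" using v(1) by (intro eq_vecI) auto
    with v(2) show False by blast
  qed
  ultimately have "Determinant.det M = Determinant.det D" by simp
  also have "\<dots> = prod_list (diag_mat D)"
    by (rule det_upper_triangular[OF _ carrier(3)]) (auto simp: D_def upper_triangular_def)
  also have "diag_mat D = [\<sigma>1 x, \<sigma>2 x, \<sigma>3 x]"
    by (simp add: diag_mat_def D_def s_def numeral_3_eq_3)
  finally show ?thesis unfolding norm by simp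
qed

subsection \<open>The ring of integers\<close>

text \<open>After scaling by D the group consists of integers. An element with least positive
  numerator generates it, by division with remainder.\<close>

lemma discrete_rat_group_cyclic:
  fixes G :: "rat set"
  assumes D: "D > 0" "\<And>g. g \<in> G \<Longrightarrow> of_int D * g \<in> \<int>"
    and closed: "\<And>g h k. g \<in> G \<Longrightarrow> h \<in> G \<Longrightarrow> g - of_int k * h \<in> G"
    and nontriv: "g1 \<in> G" "g1 \<noteq> 0"
  shows "\<exists>g0\<in>G. g0 \<noteq> 0 \<and> (\<forall>g\<in>G. \<exists>k. g = of_int k * g0)"
proof -
  define P where "P n \<longleftrightarrow> n > 0 \<and> (\<exists>g\<in>G. of_int D * g = of_nat n)" for n :: nat
  have "\<exists>n. P n"
  proof -
    obtain m where m: "of_int D * g1 = of_int m" using D(2)[OF nontriv(1)] by (auto elim: Ints_cases)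
    have "m \<noteq> 0" using m D(1) nontriv(2) by auto
    define g2 where "g2 = (if m > 0 then g1 else - g1)"
    \<comment> \<open>This is - g1, reached by two uses of the closure hypothesis.\<close>
    have "g1 - of_int 1 * g1 - of_int 1 * g1 \<in> G" using closed closed nontriv(1) by blast
    then have "g2 \<in> G" using nontriv(1) by (simp add: g2_def)
    moreover have "of_int D * g2 = of_nat (nat \<bar>m\<bar>)" using m by (simp add: g2_def)
    ultimately show ?thesis using \<open>m \<noteq> 0\<close> unfolding P_def by (intro exI[of _ "nat \<bar>m\<bar>"]) auto
  qed
  define n0 where "n0 = (LEAST n. P n)"
  have "P n0" unfolding n0_def by (rule LeastI_ex) fact
  then obtain g0 where g0: "n0 > 0" "g0 \<in> G" "of_int D * g0 = of_nat n0" unfolding P_def by blast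
  have "\<exists>k. g = of_int k * g0" if g: "g \<in> G" for g
  proof -
    obtain m where m: "of_int D * g = of_int m" using D(2)[OF g] by (auto elim: Ints_cases)
    define k where "k = m div int n0"
    define e where "e = nat (m mod int n0)"
    have e: "int e = m - k * int n0" using g0(1) by (simp add: e_def k_def minus_div_mult_eq_mod)
    have "of_int D * (g - of_int k * g0) = of_int D * g - of_int k * (of_int D * g0)"
      by (simp add: algebra_simps)
    also have "\<dots> = of_int (int e)" unfolding m g0(3) e by simp
    finally have eq: "of_int D * (g - of_int k * g0) = of_nat e" by simp
    have "e < n0" using g0(1) by (simp add: e_def nat_less_iff)
    then have "\<not> P e" unfolding n0_def by (rule not_less_Least)
    moreover have "P e" if "e > 0"
      unfolding P_def using that eq closed[OF g g0(2), of k] by (intro conjI bexI[of _ "g - of_int k * g0"])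
    ultimately have "e = 0" by auto
    with eq D(1) have "g - of_int k * g0 = 0" by simp
    then show ?thesis by auto
  qed
  moreover have "g0 \<noteq> 0" using g0(1,3) by auto
  ultimately show ?thesis using g0(2) by blast
qed

lemma of_rat_mult_of_int: "of_rat (of_int k * q) = of_int k * (of_rat q :: 'a :: field_char_0)"
  by (simp add: of_rat_mult)

lemma algebraic_int_monic_cubic:
  fixes x :: "'a :: field_char_0"
  assumes "x ^ 3 = of_int e0 + of_int e1 * x + of_int e2 * x\<^sup>2"
  shows "algebraic_int x"
proof -
  have "poly (map_poly of_int [:- e0, - e1, - e2, 1:]) x = x ^ 3 - (of_int e0 + of_int e1 * x + of_int e2 * x\<^sup>2)"
    by (simp add: map_poly_pCons algebra_simps power2_eq_square power3_eq_cube)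
  then show ?thesis unfolding algebraic_int_altdef_ipoly assms
    by (intro exI[of _ "[:- e0, - e1, - e2, 1:]"]) simp
qed

text \<open>The left side is the discriminant of z^3 - e2 z^2 - e1 z - e0 with the coefficients
  expressed by the roots. It shows that the square of the Vandermonde determinant is an integer when
  the coefficients are.\<close>

lemma cubic_discriminant:
  fixes z1 z2 z3 :: "'b :: comm_ring_1"
  shows "(z1 + z2 + z3)\<^sup>2 * (- (z1 * z2 + z2 * z3 + z1 * z3))\<^sup>2
      + 4 * (- (z1 * z2 + z2 * z3 + z1 * z3)) ^ 3 - 4 * (z1 + z2 + z3) ^ 3 * (z1 * z2 * z3)
      - 18 * (z1 + z2 + z3) * - (z1 * z2 + z2 * z3 + z1 * z3) * (z1 * z2 * z3)
      - 27 * (z1 * z2 * z3)\<^sup>2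
    = ((z2 - z1) * (z3 - z1) * (z3 - z2))\<^sup>2"
  by (simp add: algebra_simps power2_eq_square power3_eq_cube)

text \<open>The witness is the discriminant of \<open>x\<close>, by Lagrange interpolation at the conjugates.\<close>

lemma ex_integral_coeff_denominator:
  fixes x :: "'a :: number_field"
  assumes gen: "cubic_generator x" and real: "totally_real TYPE('a)"
    and x: "x ^ 3 = of_int e0 + of_int e1 * x + of_int e2 * x\<^sup>2"
  shows "\<exists>D > 0. \<forall>p q r. algebraic_int (of_rat p + of_rat q * x + of_rat r * x\<^sup>2) \<longrightarrow>
    of_int D * r \<in> \<int> \<and> (r = 0 \<longrightarrow> of_int D * q \<in> \<int>)"
proof -
  have "x ^ 3 = of_rat (of_int e0) + of_rat (of_int e1) * x + of_rat (of_int e2) * x\<^sup>2" using x by simp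
  from ex_real_embeddings[OF gen real this]
  obtain \<sigma>1 \<sigma>2 \<sigma>3 :: "'a \<Rightarrow> real" where hom: "field_hom \<sigma>1" "field_hom \<sigma>2" "field_hom \<sigma>3"
    and ne: "\<sigma>1 x \<noteq> \<sigma>2 x" "\<sigma>2 x \<noteq> \<sigma>3 x" "\<sigma>1 x \<noteq> \<sigma>3 x"
    and e: "of_rat (of_int e2) = \<sigma>1 x + \<sigma>2 x + \<sigma>3 x"
      "of_rat (of_int e1) = - (\<sigma>1 x * \<sigma>2 x + \<sigma>2 x * \<sigma>3 x + \<sigma>1 x * \<sigma>3 x)"
      "of_rat (of_int e0) = \<sigma>1 x * \<sigma>2 x * \<sigma>3 x"
    by blast
  define z1 z2 z3 where "z1 = \<sigma>1 x" and "z2 = \<sigma>2 x" and "z3 = \<sigma>3 x"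
  define V where "V = (z2 - z1) * (z3 - z1) * (z3 - z2)"
  define D where "D = e2\<^sup>2 * e1\<^sup>2 + 4 * e1 ^ 3 - 4 * e2 ^ 3 * e0 - 18 * e2 * e1 * e0 - 27 * e0\<^sup>2"
  note e' = e[unfolded of_rat_of_int_eq, folded z1_def z2_def z3_def]
  have D_eq: "real_of_int D = V\<^sup>2"
    unfolding D_def V_def of_int_add of_int_diff of_int_mult of_int_power of_int_numeral e'
    by (rule cubic_discriminant)
  then have VD: "V * V = of_int D" by (simp add: power2_eq_square)
  have "V \<noteq> 0" using ne by (simp add: V_def z1_def z2_def z3_def)
  then have "0 < V\<^sup>2" by simp
  then have "real_of_int D > 0" unfolding D_eq .
  then have "D > 0" by simp
  have int_x: "algebraic_int x" using algebraic_int_monic_cubic[OF x] .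
  have z: "algebraic_int z1" "algebraic_int z2" "algebraic_int z3"
    unfolding z1_def z2_def z3_def using hom by (simp_all add: algebraic_int_hom[OF _ int_x])
  have V: "algebraic_int V" unfolding V_def using z by (intro algebraic_int_times algebraic_int_diff)
  have coeffs: "of_int D * r \<in> \<int> \<and> (r = 0 \<longrightarrow> of_int D * q \<in> \<int>)"
    if y: "algebraic_int (of_rat p + of_rat q * x + of_rat r * x\<^sup>2)" for p q r
  proof
    let ?y = "of_rat p + of_rat q * x + of_rat r * x\<^sup>2"
    have int_y: "algebraic_int (\<sigma>1 ?y)" "algebraic_int (\<sigma>2 ?y)" "algebraic_int (\<sigma>3 ?y)"
      using hom by (simp_all add: algebraic_int_hom[OF _ y])
    have \<sigma>y: "\<sigma>1 ?y = of_rat p + of_rat q * z1 + of_rat r * z1\<^sup>2" "\<sigma>2 ?y = of_rat p + of_rat q * z2 + of_rat r * z2\<^sup>2"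
      "\<sigma>3 ?y = of_rat p + of_rat q * z3 + of_rat r * z3\<^sup>2"
      unfolding z1_def z2_def z3_def by (rule field_hom_quadratic, fact)+
    \<comment> \<open>Cramer's rule makes \<open>V * r\<close> a polynomial in algebraic integers.
      One more factor \<open>V\<close> makes the number rational, and a rational algebraic integer
      is an integer.\<close>
    have "V * of_rat r = \<sigma>1 ?y * (z3 - z2) - \<sigma>2 ?y * (z3 - z1) + \<sigma>3 ?y * (z2 - z1)"
      unfolding \<sigma>y V_def by (simp add: algebra_simps power2_eq_square)
    then have "algebraic_int (V * of_rat r)"
      using int_y z by (simp add: algebraic_int_times algebraic_int_diff algebraic_int_plus)
    with V have "algebraic_int (V * (V * of_rat r))" by (rule algebraic_int_times)
    also have "V * (V * of_rat r) = of_rat (of_int D * r)"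
      unfolding of_rat_mult_of_int VD[symmetric] by simp
    finally show "of_int D * r \<in> \<int>" by (rule of_rat_algebraic_int_imp_Ints)
    show "r = 0 \<longrightarrow> of_int D * q \<in> \<int>"
    proof
      assume "r = 0"
      have "\<sigma>2 ?y - \<sigma>1 ?y = (z2 - z1) * of_rat q"
        unfolding \<sigma>y using \<open>r = 0\<close> by (simp add: algebra_simps)
      then have "V * of_rat q = (\<sigma>2 ?y - \<sigma>1 ?y) * (z3 - z1) * (z3 - z2)"
        unfolding V_def by (simp add: mult_ac)
      then have "algebraic_int (V * of_rat q)"
        using int_y z by (simp add: algebraic_int_times algebraic_int_diff)
      with V have "algebraic_int (V * (V * of_rat q))" by (rule algebraic_int_times)
      also have "V * (V * of_rat q) = of_rat (of_int D * q)"
        unfolding of_rat_mult_of_int VD[symmetric] by simp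
      finally show "of_int D * q \<in> \<int>" by (rule of_rat_algebraic_int_imp_Ints)
    qed
  qed
  show ?thesis
    by (rule exI[of _ D], rule conjI[OF \<open>D > 0\<close>], intro allI impI, rule coeffs)
qed

definition integral_basis :: "'a :: number_field \<Rightarrow> 'a \<Rightarrow> bool" where
  "integral_basis w1 w2 \<longleftrightarrow>
     (\<forall>p q r. of_rat p + of_rat q * w1 + of_rat r * w2 = 0 \<longrightarrow> p = 0 \<and> q = 0 \<and> r = 0) \<and>
     (\<forall>y. algebraic_int y \<longleftrightarrow> (\<exists>i j k. y = of_int i + of_int j * w1 + of_int k * w2))"

text \<open>A triangular basis: \<open>R\<close> collects the coefficients of x^2 of all integers,
  \<open>Q\<close> those of x of the integers without a term in x^2. Both groups are cyclic by the
  bounded denominator. Lifts of their generators, together with 1, form a basis, since multiples of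
  w2 and then of w1 can be subtracted until a rational integer is left.\<close>

lemma ex_integral_basis:
  assumes deg: "field_degree TYPE('a :: number_field) = 3" and real: "totally_real TYPE('a)"
  shows "\<exists>w1 w2 :: 'a. integral_basis w1 w2"
proof -
  obtain x :: 'a and e0 e1 e2 :: int where gen: "cubic_generator x"
    and x: "x ^ 3 = of_int e0 + of_int e1 * x + of_int e2 * x\<^sup>2"
    using ex_integral_cubic_generator[OF deg] by blast
  have int_x: "algebraic_int x" using algebraic_int_monic_cubic[OF x] .
  obtain D where D: "D > 0"
    and DR: "\<And>p q r. algebraic_int (of_rat p + of_rat q * x + of_rat r * x\<^sup>2) \<Longrightarrow> of_int D * r \<in> \<int>"
    and DQ: "\<And>p q. algebraic_int (of_rat p + of_rat q * x) \<Longrightarrow> of_int D * q \<in> \<int>"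
    using ex_integral_coeff_denominator[OF gen real x]
    by (metis (no_types, lifting) add.right_neutral mult_zero_left of_rat_0)
  define R where "R = {r. \<exists>p q. algebraic_int (of_rat p + of_rat q * x + of_rat r * x\<^sup>2)}"
  define Q where "Q = {q. \<exists>p. algebraic_int (of_rat p + of_rat q * x)}"
  have "1 \<in> R" unfolding R_def
  proof (intro CollectI exI)
    show "algebraic_int (of_rat 0 + of_rat 0 * x + of_rat 1 * x\<^sup>2)"
      using algebraic_int_times[OF int_x int_x] by (simp add: power2_eq_square)
  qed
  have "\<exists>r0\<in>R. r0 \<noteq> 0 \<and> (\<forall>r\<in>R. \<exists>k. r = of_int k * r0)"
  proof (rule discrete_rat_group_cyclic[OF D _ _ \<open>1 \<in> R\<close>])
    show "g - of_int k * h \<in> R" if gh: "g \<in> R" "h \<in> R" for g h k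
    proof -
      obtain p q p' q' where "algebraic_int (of_rat p + of_rat q * x + of_rat g * x\<^sup>2)"
        "algebraic_int (of_rat p' + of_rat q' * x + of_rat h * x\<^sup>2)"
        using gh unfolding R_def by blast
      then have "algebraic_int ((of_rat p + of_rat q * x + of_rat g * x\<^sup>2) - of_int k * (of_rat p' + of_rat q' * x + of_rat h * x\<^sup>2))"
        by (intro algebraic_int_diff algebraic_int_times algebraic_int_of_int)
      moreover have "(of_rat p + of_rat q * x + of_rat g * x\<^sup>2) - of_int k * (of_rat p' + of_rat q' * x + of_rat h * x\<^sup>2)
          = of_rat (p - of_int k * p') + of_rat (q - of_int k * q') * x + of_rat (g - of_int k * h) * x\<^sup>2"
        unfolding of_rat_diff of_rat_mult_of_int by (simp add: algebra_simps)
      ultimately show ?thesis unfolding R_def by (intro CollectI exI) (simp only:)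
    qed
  qed (use DR in \<open>auto simp: R_def\<close>)
  then obtain r0 p2 q2 where r0: "r0 \<noteq> 0" "\<And>r. r \<in> R \<Longrightarrow> \<exists>k. r = of_int k * r0"
    and int_w2: "algebraic_int (of_rat p2 + of_rat q2 * x + of_rat r0 * x\<^sup>2)"
    unfolding R_def by blast
  have "1 \<in> Q" unfolding Q_def
  proof (intro CollectI exI)
    show "algebraic_int (of_rat 0 + of_rat 1 * x)" using int_x by simp
  qed
  have "\<exists>q0\<in>Q. q0 \<noteq> 0 \<and> (\<forall>q\<in>Q. \<exists>k. q = of_int k * q0)"
  proof (rule discrete_rat_group_cyclic[OF D _ _ \<open>1 \<in> Q\<close>])
    show "g - of_int k * h \<in> Q" if gh: "g \<in> Q" "h \<in> Q" for g h k
    proof -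
      obtain p p' where "algebraic_int (of_rat p + of_rat g * x)" "algebraic_int (of_rat p' + of_rat h * x)"
        using gh unfolding Q_def by blast
      then have "algebraic_int ((of_rat p + of_rat g * x) - of_int k * (of_rat p' + of_rat h * x))"
        by (intro algebraic_int_diff algebraic_int_times algebraic_int_of_int)
      moreover have "(of_rat p + of_rat g * x) - of_int k * (of_rat p' + of_rat h * x)
          = of_rat (p - of_int k * p') + of_rat (g - of_int k * h) * x"
        unfolding of_rat_diff of_rat_mult_of_int by (simp add: algebra_simps)
      ultimately show ?thesis unfolding Q_def by (intro CollectI exI) (simp only:)
    qed
  qed (use DQ in \<open>auto simp: Q_def\<close>)
  then obtain q0 p1 where q0: "q0 \<noteq> 0" "\<And>q. q \<in> Q \<Longrightarrow> \<exists>k. q = of_int k * q0"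
    and int_w1: "algebraic_int (of_rat p1 + of_rat q0 * x)"
    unfolding Q_def by blast
  define w1 where "w1 = of_rat p1 + of_rat q0 * x"
  define w2 where "w2 = of_rat p2 + of_rat q2 * x + of_rat r0 * x\<^sup>2"
  note int_w = int_w1[folded w1_def] int_w2[folded w2_def]
  have int_multiple: "algebraic_int (of_int k * w1)" "algebraic_int (of_int k * w2)" for k
    using int_w by (simp_all add: algebraic_int_times algebraic_int_of_int)
  have indep: "p = 0 \<and> q = 0 \<and> r = 0" if 0: "of_rat p + of_rat q * w1 + of_rat r * w2 = 0" for p q r
  proof -
    have "of_rat (p + q * p1 + r * p2) + of_rat (q * q0 + r * q2) * x + of_rat (r * r0) * x\<^sup>2 = 0"
      using 0 unfolding w1_def w2_def of_rat_add of_rat_mult by (simp add: algebra_simps)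
    then have "p + q * p1 + r * p2 = 0 \<and> q * q0 + r * q2 = 0 \<and> r * r0 = 0"
      using gen unfolding cubic_generator_def by blast
    then show ?thesis using q0(1) r0(1) by auto
  qed
  have rep: "\<exists>i j k. y = of_int i + of_int j * w1 + of_int k * w2" if y: "algebraic_int y" for y
  proof -
    obtain p q r where pqr: "y = of_rat p + of_rat q * x + of_rat r * x\<^sup>2"
      using gen unfolding cubic_generator_def by blast
    then have "r \<in> R" using y unfolding R_def by blast
    then obtain k where k: "r = of_int k * r0" using r0(2) by blast
    have "algebraic_int (y - of_int k * w2)"
      using y int_multiple(2) by (rule algebraic_int_diff)
    moreover have yk: "y - of_int k * w2 = of_rat (p - of_int k * p2) + of_rat (q - of_int k * q2) * x"
      unfolding pqr w2_def k of_rat_diff of_rat_mult_of_int by (simp add: algebra_simps)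
    ultimately have "q - of_int k * q2 \<in> Q" unfolding Q_def by auto
    then obtain j where j: "q - of_int k * q2 = of_int j * q0" using q0(2) by blast
    have "algebraic_int (y - of_int k * w2 - of_int j * w1)"
      using \<open>algebraic_int (y - of_int k * w2)\<close> int_multiple(1) by (rule algebraic_int_diff)
    moreover have yj: "y - of_int k * w2 - of_int j * w1 = of_rat (p - of_int k * p2 - of_int j * p1)"
      unfolding yk j w1_def of_rat_diff of_rat_mult_of_int by (simp add: algebra_simps)
    ultimately have "p - of_int k * p2 - of_int j * p1 \<in> \<int>"
      using of_rat_algebraic_int_imp_Ints[where 'a = 'a] by simp
    then obtain i where "p - of_int k * p2 - of_int j * p1 = of_int i" by (rule Ints_cases)
    then have "y - of_int k * w2 - of_int j * w1 = of_int i" using yj by simp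
    then have "y = of_int i + of_int j * w1 + of_int k * w2" by (simp add: algebra_simps)
    then show ?thesis by blast
  qed
  have int: "algebraic_int (of_int i + of_int j * w1 + of_int k * w2)" for i j k
    by (intro algebraic_int_plus int_multiple algebraic_int_of_int)
  have "integral_basis w1 w2"
    unfolding integral_basis_def
    by (rule conjI; (intro allI impI, erule indep)?) (auto intro: rep int)
  then show ?thesis by blast
qed

lemma integral_basis_coeffs_unique:
  assumes "integral_basis w1 w2"
    and "of_int i + of_int j * w1 + of_int k * w2 = of_int i' + of_int j' * w1 + of_int k' * w2"
  shows "i = i' \<and> j = j' \<and> k = k'"
proof -
  have "of_rat (of_int (i - i')) + of_rat (of_int (j - j')) * w1 + of_rat (of_int (k - k')) * w2
    = (of_int i + of_int j * w1 + of_int k * w2) - (of_int i' + of_int j' * w1 + of_int k' * w2)"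
    unfolding of_rat_of_int_eq by (simp add: algebra_simps)
  also have "\<dots> = 0" unfolding assms(2) by simp
  finally have "of_rat (of_int (i - i')) + of_rat (of_int (j - j')) * w1 + of_rat (of_int (k - k')) * w2 = 0" .
  then have "(of_int (i - i') :: rat) = 0 \<and> (of_int (j - j') :: rat) = 0 \<and> (of_int (k - k') :: rat) = 0"
    using assms(1) unfolding integral_basis_def by blast
  then show ?thesis by simp
qed

lemma algebraic_int_iff_integral_basis:
  assumes "integral_basis w1 w2"
  shows "algebraic_int y \<longleftrightarrow> (\<exists>i j k. y = of_int i + of_int j * w1 + of_int k * w2)"
  using assms[unfolded integral_basis_def, THEN conjunct2] by (rule spec)

lemma integral_basis_shift:
  fixes w1 w2 :: "'a :: number_field"
  assumes "integral_basis w1 w2"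
  shows "integral_basis (w1 - of_int v) (w2 - of_int u)"
  unfolding integral_basis_def
proof (intro conjI allI impI)
  fix p q r :: rat
  assume "of_rat p + of_rat q * (w1 - of_int v) + of_rat r * (w2 - of_int u) = 0"
  then have "of_rat (p - q * of_int v - r * of_int u) + of_rat q * w1 + of_rat r * w2 = 0"
    unfolding of_rat_diff of_rat_mult of_rat_of_int_eq by (simp add: algebra_simps)
  then have *: "p - q * of_int v - r * of_int u = 0 \<and> q = 0 \<and> r = 0"
    using assms unfolding integral_basis_def by blast
  show q: "q = 0" and r: "r = 0" using * by blast+
  from * show "p = 0" unfolding q r by simp
next
  fix y :: 'a
  have y: "algebraic_int y \<longleftrightarrow> (\<exists>i j k. y = of_int i + of_int j * w1 + of_int k * w2)"
    by (rule algebraic_int_iff_integral_basis[OF assms])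
  show "algebraic_int y \<longleftrightarrow>
    (\<exists>i j k. y = of_int i + of_int j * (w1 - of_int v) + of_int k * (w2 - of_int u))"
    unfolding y
  proof safe
    fix i j k
    have "of_int i + of_int j * w1 + of_int k * w2
        = of_int (i + j * v + k * u) + of_int j * (w1 - of_int v) + of_int k * (w2 - of_int u)"
      by (simp add: algebra_simps)
    then show "\<exists>i' j' k'. of_int i + of_int j * w1 + of_int k * w2
        = of_int i' + of_int j' * (w1 - of_int v) + of_int k' * (w2 - of_int u)" by blast
  next
    fix i j k
    have "of_int i + of_int j * (w1 - of_int v) + of_int k * (w2 - of_int u)
        = of_int (i - j * v - k * u) + of_int j * w1 + of_int k * w2"
      by (simp add: algebra_simps)
    then show "\<exists>i' j' k'. of_int i + of_int j * (w1 - of_int v) + of_int k * (w2 - of_int u)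
        = of_int i' + of_int j' * w1 + of_int k' * w2" by blast
  qed
qed

text \<open>Once the integral basis is shifted so that the product of its two irrational elements is an
  integer, associativity forces its multiplication table to be that of a binary cubic form
  \<open>(a, b, c, d)\<close>.\<close>

lemma ex_delone_faddeev_generator:
  assumes deg: "field_degree TYPE('a :: number_field) = 3" and real: "totally_real TYPE('a)"
  shows "\<exists>(t :: 'a) a b c d :: int. a \<noteq> 0 \<and> t \<notin> \<rat>
    \<and> of_int a * t ^ 3 = - of_int b * t\<^sup>2 - of_int c * t - of_int d
    \<and> (\<forall>y. algebraic_int y \<longleftrightarrow>
        (\<exists>i j k. y = of_int i + of_int j * (of_int a * t) + of_int k * (of_int a * t\<^sup>2 + of_int b * t)))"
proof -
  obtain w1 w2 :: 'a where w: "integral_basis w1 w2" using ex_integral_basis[OF assms] by blast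
  have int: "algebraic_int (of_int i + of_int j * w1 + of_int k * w2)" for i j k
    using w unfolding integral_basis_def by blast
  have "algebraic_int w1" "algebraic_int w2" using int[of 0 1 0] int[of 0 0 1] by simp_all
  then have "algebraic_int (w1 * w2)" by (rule algebraic_int_times)
  then obtain n u v where n: "w1 * w2 = of_int n + of_int u * w1 + of_int v * w2"
    using w unfolding integral_basis_def by blast
  define x y where "x = w1 - of_int v" and "y = w2 - of_int u"
  have basis: "integral_basis x y" unfolding x_def y_def using w by (rule integral_basis_shift)
  \<comment> \<open>The shift completes the product: (w1 - v) (w2 - u) = w1 w2 - u w1 - v w2 + u
    v.\<close>
  define N where "N = n + u * v"
  have xy: "x * y = of_int N" unfolding x_def y_def N_def using n by (simp add: algebra_simps)
  have rep: "\<exists>i j k. z = of_int i + of_int j * x + of_int k * y" if "algebraic_int z" for z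
    using basis that unfolding integral_basis_def by blast
  have int: "algebraic_int (of_int i + of_int j * x + of_int k * y)" for i j k
    using basis unfolding integral_basis_def by blast
  have int_xy: "algebraic_int x" "algebraic_int y" using int[of 0 1 0] int[of 0 0 1] by simp_all
  obtain m s a where x2: "x * x = of_int m + of_int s * x + of_int a * y"
    using rep[OF algebraic_int_times[OF int_xy(1,1)]] by blast
  obtain m' s' c where y2: "y * y = of_int m' + of_int s' * x + of_int c * y"
    using rep[OF algebraic_int_times[OF int_xy(2,2)]] by blast
  \<comment> \<open>The product x x y is expanded in two ways, and the coefficients in the basis 1,
    x, y are compared.\<close>
  have "of_int 0 + of_int N * x + of_int 0 * y = (x * y) * x" unfolding xy by simp
  also have "\<dots> = (x * x) * y" by (simp only: mult_ac)
  also have "\<dots> = of_int m * y + of_int s * (x * y) + of_int a * (y * y)" unfolding x2 by (simp add: algebra_simps)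
  also have "\<dots> = of_int (s * N + a * m') + of_int (a * s') * x + of_int (m + a * c) * y"
    unfolding xy y2 by (simp add: algebra_simps)
  finally have "0 = s * N + a * m' \<and> N = a * s' \<and> 0 = m + a * c"
    by (rule integral_basis_coeffs_unique[OF basis])
  then have N: "N = a * s'" and m: "m = - (a * c)" by auto
  have "a \<noteq> 0"
  proof
    assume "a = 0"
    then have "x * y = 0" using xy N by simp
    then have "x = 0 \<or> y = 0" by simp
    then show False
      using integral_basis_coeffs_unique[OF basis, of 0 1 0 0 0 0]
        integral_basis_coeffs_unique[OF basis, of 0 0 1 0 0 0] by auto
  qed
  \<comment> \<open>Now x y = a s' becomes t y = s'. Multiplying a t^2 = s t + y - c by t gives the
    cubic relation, with b = - s and d = - s'.\<close>
  define t where "t = x / of_int a"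
  have x_t: "x = of_int a * t" using \<open>a \<noteq> 0\<close> by (simp add: t_def)
  have "of_int a * (of_int a * t\<^sup>2) = of_int a * (of_int s * t + y - of_int c)"
    using x2 unfolding m x_t by (simp add: algebra_simps power2_eq_square)
  then have at2: "of_int a * t\<^sup>2 = of_int s * t + y - of_int c" using \<open>a \<noteq> 0\<close> by simp
  have "of_int a * (t * y) = of_int a * of_int s'" using xy unfolding x_t N by (simp add: mult.assoc)
  then have ty: "t * y = of_int s'" using \<open>a \<noteq> 0\<close> by simp
  have "of_int a * t ^ 3 = t * (of_int a * t\<^sup>2)" by (simp add: power2_eq_square power3_eq_cube)
  also have "\<dots> = of_int s * t\<^sup>2 + t * y - of_int c * t"
    unfolding at2 by (simp add: algebra_simps power2_eq_square)
  finally have cubic: "of_int a * t ^ 3 = - of_int (- s) * t\<^sup>2 - of_int c * t - of_int (- s')"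
    unfolding ty by simp
  have "t \<notin> \<rat>"
  proof
    assume "t \<in> \<rat>"
    then have "x \<in> \<rat>" unfolding x_t by simp
    then obtain q where "x = of_rat q" by (rule Rats_cases)
    then have "of_rat (- q) + of_rat 1 * x + of_rat 0 * y = 0" by (simp add: of_rat_minus)
    then have "(1 :: rat) = 0" using basis unfolding integral_basis_def by blast
    then show False by simp
  qed
  have y_t: "y = of_int a * t\<^sup>2 + of_int (- s) * t + of_int c" using at2 by (simp add: algebra_simps)
  \<comment> \<open>\<open>W\<close> is a t^2 + b t; it differs from y by the integer c, so it can
    take the place of y next to 1.\<close>
  define W where "W = of_int a * t\<^sup>2 + of_int (- s) * t"
  have y_W: "y = W + of_int c" using y_t unfolding W_def .
  have "algebraic_int z \<longleftrightarrow> (\<exists>i j k. z = of_int i + of_int j * x + of_int k * W)" for z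
    unfolding algebraic_int_iff_integral_basis[OF basis]
  proof safe
    fix i j k
    have "of_int i + of_int j * x + of_int k * y = of_int (i + k * c) + of_int j * x + of_int k * W"
      unfolding y_W by (simp add: algebra_simps)
    then show "\<exists>i' j' k'. of_int i + of_int j * x + of_int k * y = of_int i' + of_int j' * x + of_int k' * W"
      by blast
  next
    fix i j k
    have "of_int i + of_int j * x + of_int k * W = of_int (i - k * c) + of_int j * x + of_int k * y"
      unfolding y_W by (simp add: algebra_simps)
    then show "\<exists>i' j' k'. of_int i + of_int j * x + of_int k * W = of_int i' + of_int j' * x + of_int k' * y"
      by blast
  qed
  note integers = this[unfolded W_def x_t]
  show ?thesis
    by (rule exI[of _ t], rule exI[of _ a], rule exI[of _ "- s"], rule exI[of _ c], rule exI[of _ "- s'"])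
      (intro conjI allI integers cubic \<open>a \<noteq> 0\<close> \<open>t \<notin> \<rat>\<close>)
qed

subsection \<open>Admissible bases\<close>

lemma inj_to_tensor: "inj to_tensor"
proof (rule injI)
  fix x y :: 'a
  assume eq: "to_tensor x = to_tensor y"
  have "rat_vs.representation (set rat_basis) x b = rat_vs.representation (set rat_basis) y b" for b
    using arg_cong[OF eq, of "\<lambda>s. tensor_coord s b"] by (simp add: tensor_coord_to_tensor)
  then show "x = y" by (subst rat_basis_expansion, subst (2) rat_basis_expansion) simp
qed

lemma no_half_space_if_positive_relation:
  fixes p q r :: "'a :: number_field"
  assumes "distinct [p, q, r]" and pos: "0 < a" "0 < b" "0 < c"
    and rel: "of_rat a * p + of_rat b * q + of_rat c * r = 0"
  shows "no_half_space {p, q, r}"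
proof -
  have "distinct [to_tensor p, to_tensor q, to_tensor r]"
    using assms(1) inj_to_tensor by (auto dest: injD)
  moreover have "of_rat a *\<^sub>R to_tensor p + of_rat b *\<^sub>R to_tensor q + of_rat c *\<^sub>R to_tensor r = 0"
    using arg_cong[OF rel, of to_tensor] by (simp only: to_tensor_add to_tensor_scale to_tensor_0)
  moreover have "0 < real_of_rat a" "0 < real_of_rat b" "0 < real_of_rat c" using pos by simp_all
  ultimately have "0 \<in> top_of_set (span {to_tensor p, to_tensor q, to_tensor r}) interior_of
      (convex hull {to_tensor p, to_tensor q, to_tensor r})"
    by (intro zero_interior_convex_hull)
  then show ?thesis by (simp add: no_half_space_def)
qed

lemma mem_int_span_3:
  "y \<in> int_mod.span {1, x, w :: 'a :: number_field} \<longleftrightarrow> (\<exists>p q r. y = of_int p + of_int q * x + of_int r * w)"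
  (is "_ = ?R")
proof
  assume "y \<in> int_mod.span {1, x, w}"
  then obtain p q r where "y - of_int p * 1 - of_int q * x - of_int r * w = 0"
    by (auto simp only: int_mod.span_breakdown_eq int_mod.span_empty singleton_iff)
  then have "y = of_int p + of_int q * x + of_int r * w" by (simp add: algebra_simps)
  then show ?R by blast
next
  assume ?R
  then obtain p q r where y: "y = of_int p * 1 + of_int q * x + of_int r * w" by auto
  show "y \<in> int_mod.span {1, x, w}"
    unfolding y by (intro int_mod.span_add int_mod.span_scale int_mod.span_base) simp_all
qed

text \<open>Since 1 and t are independent over the rationals, proportional forms would have
  proportional coefficient vectors, against the nonzero determinant.\<close>

lemma linear_forms_not_proportional:
  fixes t :: "'a :: field_char_0" and x y x' y' :: int
  assumes t: "t \<notin> \<rat>" and det: "x' * y - x * y' \<noteq> 0"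
    and eq: "of_rat u * (of_int x - of_int y * t) = of_rat v * (of_int x' - of_int y' * t)"
  shows "u = 0 \<and> v = 0"
proof -
  define m n where "m = u * of_int x - v * of_int x'" and "n = u * of_int y - v * of_int y'"
  have mn: "of_rat m = of_rat n * t"
    using eq unfolding m_def n_def of_rat_diff of_rat_mult of_rat_of_int_eq
    by (simp add: algebra_simps)
  have n: "n = 0"
  proof (rule ccontr)
    assume "n \<noteq> 0"
    then have "t = of_rat (m / n)" using mn by (simp add: of_rat_divide)
    with t show False by simp
  qed
  then have m: "m = 0" using mn by simp
  have uv: "u * of_int x = v * of_int x'" "u * of_int y = v * of_int y'" using m n by (simp_all add: m_def n_def)
  have "u * of_int (x' * y - x * y') = of_int x' * (u * of_int y) - of_int y' * (u * of_int x)"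
    by (simp add: algebra_simps)
  also have "\<dots> = 0" unfolding uv by simp
  finally have u: "u = 0" using det unfolding mult_eq_0_iff of_int_eq_0_iff by blast
  have "v = 0"
  proof (rule ccontr)
    assume "v \<noteq> 0"
    then have "x' = 0" "y' = 0" using uv unfolding u by simp_all
    with det show False by simp
  qed
  with u show ?thesis by blast
qed

section \<open>The ideal spanned by 1, t, t^2 and its basis of products\<close>

text \<open>The coefficients on the right are integer polynomials in a, b, c, d: the multipliers a t
  and a t^2 + b t let t^3 be reduced without division by a. For integer coefficients this is the
  stability of the span of 1, t, t^2 under the ring of integers.\<close>

lemma mult_delone_faddeev:
  fixes t :: "'b :: comm_ring_1"
  assumes cubic: "a * t ^ 3 = - b * t\<^sup>2 - c * t - d"
  shows "(i + j * (a * t) + k * (a * t\<^sup>2 + b * t)) * (p + q * t + r * t\<^sup>2)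
    = (i * p - j * (r * d) - k * (q * d)) + (i * q + j * (a * p - r * c) + k * (p * b - q * c - r * d)) * t
      + (i * r + j * (a * q - r * b) + k * (p * a - r * c)) * t\<^sup>2"
proof -
  have 1: "a * t * (p + q * t + r * t\<^sup>2) = - (r * d) + (a * p - r * c) * t + (a * q - r * b) * t\<^sup>2"
  proof -
    have "a * t * (p + q * t + r * t\<^sup>2) = a * p * t + a * q * t\<^sup>2 + r * (a * t ^ 3)"
      by (simp add: algebra_simps power2_eq_square power3_eq_cube)
    then show ?thesis unfolding cubic by (simp add: algebra_simps)
  qed
  have 2: "(a * t\<^sup>2 + b * t) * (p + q * t + r * t\<^sup>2) = - (q * d) + (p * b - q * c - r * d) * t + (p * a - r * c) * t\<^sup>2"
  proof -
    have "(a * t\<^sup>2 + b * t) * (p + q * t + r * t\<^sup>2)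
        = p * (a * t\<^sup>2 + b * t) + q * (a * t ^ 3 + b * t\<^sup>2) + r * ((a * t ^ 3 + b * t\<^sup>2) * t)"
      by (simp add: algebra_simps power2_eq_square power3_eq_cube)
    also have "a * t ^ 3 + b * t\<^sup>2 = - c * t - d" unfolding cubic by simp
    finally show ?thesis by (simp add: algebra_simps power2_eq_square)
  qed
  have "(i + j * (a * t) + k * (a * t\<^sup>2 + b * t)) * (p + q * t + r * t\<^sup>2)
    = i * (p + q * t + r * t\<^sup>2) + j * (a * t * (p + q * t + r * t\<^sup>2))
      + k * ((a * t\<^sup>2 + b * t) * (p + q * t + r * t\<^sup>2))"
    by (simp only: distrib_right mult.assoc)
  then show ?thesis unfolding 1 2 by (simp add: algebra_simps)
qed

lemma fractional_ideal_delone_faddeev: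
  fixes t :: "'a :: number_field"
  assumes "a \<noteq> 0" and cubic: "of_int a * t ^ 3 = - of_int b * t\<^sup>2 - of_int c * t - of_int d"
    and integers: "\<And>y. algebraic_int y \<longleftrightarrow>
      (\<exists>i j k. y = of_int i + of_int j * (of_int a * t) + of_int k * (of_int a * t\<^sup>2 + of_int b * t))"
  shows "fractional_ideal (int_mod.span {1, t, t\<^sup>2})"
  unfolding fractional_ideal_def
proof (intro conjI ballI)
  let ?I = "int_mod.span {1, t, t\<^sup>2}"
  show "0 \<in> ?I" by (rule int_mod.span_zero)
  show "?I \<noteq> {0}"
  proof
    assume "?I = {0}"
    moreover have "1 \<in> ?I" by (rule int_mod.span_base) simp
    ultimately have "1 \<in> {0 :: 'a}" by (simp only:)
    then show False by simp
  qed
  show "x + y \<in> ?I" if "x \<in> ?I" "y \<in> ?I" for x y using that by (rule int_mod.span_add)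
  show "y * z \<in> ?I" if y: "y \<in> ring_of_integers" and z: "z \<in> ?I" for y z
  proof -
    from y obtain i j k where
      y: "y = of_int i + of_int j * (of_int a * t) + of_int k * (of_int a * t\<^sup>2 + of_int b * t)"
      unfolding ring_of_integers_def mem_Collect_eq integers by blast
    from z obtain p q r where z: "z = of_int p + of_int q * t + of_int r * t\<^sup>2"
      unfolding mem_int_span_3 by blast
    have "y * z = of_int (i * p - j * (r * d) - k * (q * d))
      + of_int (i * q + j * (a * p - r * c) + k * (p * b - q * c - r * d)) * t
      + of_int (i * r + j * (a * q - r * b) + k * (p * a - r * c)) * t\<^sup>2"
      unfolding y z mult_delone_faddeev[OF cubic] by simp
    then show ?thesis unfolding mem_int_span_3 by blast
  qed
  have at: "algebraic_int (of_int a * t)"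
    unfolding integers by (rule exI[of _ 0], rule exI[of _ 1], rule exI[of _ 0]) simp
  show "\<exists>e\<in>ring_of_integers. e \<noteq> 0 \<and> (\<forall>z\<in>?I. e * z \<in> ring_of_integers)"
  proof (intro bexI conjI ballI)
    \<comment> \<open>The denominator a^2 suffices because a t is integral and a^2 t^2 is its
      square.\<close>
    show "(of_int a)\<^sup>2 \<in> (ring_of_integers :: 'a set)"
      unfolding ring_of_integers_def power2_eq_square
      by (simp add: algebraic_int_times algebraic_int_of_int)
    show "(of_int a)\<^sup>2 \<noteq> (0 :: 'a)" using \<open>a \<noteq> 0\<close> by simp
    fix z assume "z \<in> ?I"
    then obtain p q r where z: "z = of_int p + of_int q * t + of_int r * t\<^sup>2"
      unfolding mem_int_span_3 by blast
    have "(of_int a)\<^sup>2 * z = of_int (a\<^sup>2 * p) + of_int (a * q) * (of_int a * t) + of_int r * ((of_int a * t) * (of_int a * t))"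
      unfolding z power2_eq_square of_int_mult by (simp only: distrib_left mult_ac)
    also have "algebraic_int \<dots>"
      by (intro algebraic_int_plus algebraic_int_times[OF algebraic_int_of_int] at algebraic_int_times[OF at at] algebraic_int_of_int)
    finally show "(of_int a)\<^sup>2 * z \<in> ring_of_integers" unfolding ring_of_integers_def by simp
  qed
qed

text \<open>The forms l1, l2 are a unimodular change of 1, t, so their quadratic monomials span the
  same lattice as 1, t, t^2. The three products span these monomials since l1^2 = - l1 l3 - l1 l2
  and l2^2 = - l2 l3 - l1 l2.\<close>

lemma span_products_unimodular:
  fixes t :: "'a :: number_field" and x y x' y' :: int
  assumes det: "x' * y - x * y' = 1"
  defines "l1 \<equiv> of_int x - of_int y * t" and "l2 \<equiv> of_int x' - of_int y' * t"
  defines "l3 \<equiv> - (l1 + l2)"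
  shows "int_mod.span {l2 * l3, l1 * l3, l1 * l2} = int_mod.span {1, t, t\<^sup>2}"
proof -
  let ?S = "{l2 * l3, l1 * l3, l1 * l2}"
  have r: "l2 * l3 \<in> int_mod.span ?S" "l1 * l3 \<in> int_mod.span ?S" "l1 * l2 \<in> int_mod.span ?S"
    by (simp_all add: int_mod.span_base)
  have "l1 * l1 = - (l1 * l3) - l1 * l2" "l2 * l2 = - (l2 * l3) - l1 * l2"
    by (simp_all add: l3_def algebra_simps)
  then have sq: "l1 * l1 \<in> int_mod.span ?S" "l2 * l2 \<in> int_mod.span ?S"
    using r by (simp_all only: int_mod.span_diff int_mod.span_neg)
  have prod: "(of_int e * l1 + of_int f * l2) * (of_int g * l1 + of_int h * l2) \<in> int_mod.span ?S" for e f g h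
  proof -
    have "(of_int e * l1 + of_int f * l2) * (of_int g * l1 + of_int h * l2)
        = of_int (e * g) * (l1 * l1) + of_int (e * h + f * g) * (l1 * l2) + of_int (f * h) * (l2 * l2)"
      by (simp add: algebra_simps)
    also have "\<dots> \<in> int_mod.span ?S" by (intro int_mod.span_add int_mod.span_scale r sq)
    finally show ?thesis .
  qed
  have det': "(of_int x' * of_int y - of_int x * of_int y' :: 'a) = 1"
    using arg_cong[OF det, of "of_int :: int \<Rightarrow> 'a"] by simp
  \<comment> \<open>The inverse of the change of basis: 1, and below t, are written as integer
    combinations of l1 and l2.\<close>
  have "of_int (- y') * l1 + of_int y * l2 = of_int x' * of_int y - of_int x * of_int y'"
    by (simp add: l1_def l2_def algebra_simps)
  then have one: "1 = of_int (- y') * l1 + of_int y * l2" unfolding det' by simp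
  have "of_int (- x') * l1 + of_int x * l2 = (of_int x' * of_int y - of_int x * of_int y') * t"
    by (simp add: l1_def l2_def algebra_simps)
  then have t: "t = of_int (- x') * l1 + of_int x * l2" unfolding det' by simp
  have "1 * 1 \<in> int_mod.span ?S" "1 * t \<in> int_mod.span ?S" "t * t \<in> int_mod.span ?S"
    by (subst (1 2) one, rule prod) (subst one, subst t, rule prod, subst (1 2) t, rule prod)
  then have "{1, t, t\<^sup>2} \<subseteq> int_mod.span ?S" by (simp add: power2_eq_square)
  moreover have "(of_int e + of_int f * t) * (of_int g + of_int h * t) \<in> int_mod.span {1, t, t\<^sup>2}" for e f g h
  proof -
    have "(of_int e + of_int f * t) * (of_int g + of_int h * t)
        = of_int (e * g) + of_int (e * h + f * g) * t + of_int (f * h) * t\<^sup>2"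
      by (simp add: algebra_simps power2_eq_square)
    then show ?thesis unfolding mem_int_span_3 by blast
  qed
  note prod_t = this
  have l: "l1 = of_int x + of_int (- y) * t" "l2 = of_int x' + of_int (- y') * t"
    "l3 = of_int (- x - x') + of_int (y + y') * t"
    by (simp_all add: l1_def l2_def l3_def algebra_simps)
  have "?S \<subseteq> int_mod.span {1, t, t\<^sup>2}" unfolding l by (simp only: insert_subset prod_t empty_subsetI simp_thms)
  ultimately show ?thesis unfolding int_mod.span_eq by blast
qed

text \<open>Divided by l1^2, an integer relation between the products becomes a quadratic relation
  for l2 / l1, with coefficients - j, k - i - j, - i.\<close>

lemma int_basis_products:
  fixes l1 l2 :: "'a :: number_field"
  assumes "l1 \<noteq> 0" and gen: "cubic_generator (l2 / l1)"
  defines "l3 \<equiv> - (l1 + l2)"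
  shows "int_basis [l2 * l3, l1 * l3, l1 * l2] (int_mod.span {l2 * l3, l1 * l3, l1 * l2})"
proof -
  define z where "z = l2 / l1"
  have l2: "l2 = z * l1" using assms(1) by (simp add: z_def)
  have indep: "i = 0 \<and> j = 0 \<and> k = 0"
    if "of_int i * (l2 * l3) + of_int j * (l1 * l3) + of_int k * (l1 * l2) = 0" for i j k
  proof -
    have "of_int i * (l2 * l3) + of_int j * (l1 * l3) + of_int k * (l1 * l2)
      = l1\<^sup>2 * (of_rat (of_int (- j)) + of_rat (of_int (k - i - j)) * z + of_rat (of_int (- i)) * z\<^sup>2)"
      unfolding l3_def l2 of_rat_of_int_eq by (simp add: algebra_simps power2_eq_square)
    then have "of_rat (of_int (- j)) + of_rat (of_int (k - i - j)) * z + of_rat (of_int (- i)) * z\<^sup>2 = 0"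
      using that assms(1) by simp
    then have "(of_int (- j) :: rat) = 0 \<and> (of_int (k - i - j) :: rat) = 0 \<and> (of_int (- i) :: rat) = 0"
      using gen unfolding cubic_generator_def z_def by blast
    then show ?thesis unfolding of_int_eq_0_iff by simp
  qed
  have ne: "l2 * l3 \<noteq> l1 * l3" "l2 * l3 \<noteq> l1 * l2" "l1 * l3 \<noteq> l1 * l2"
    using indep[of 1 "-1" 0] indep[of 1 0 "-1"] indep[of 0 1 "-1"] by auto
  have "int_mod.independent {l2 * l3, l1 * l3, l1 * l2}"
  proof
    assume "int_mod.dependent {l2 * l3, l1 * l3, l1 * l2}"
    then obtain u where u: "\<exists>v\<in>{l2 * l3, l1 * l3, l1 * l2}. u v \<noteq> 0"
      and sum: "(\<Sum>v\<in>{l2 * l3, l1 * l3, l1 * l2}. of_int (u v) * v) = 0"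
      by (subst (asm) int_mod.dependent_finite) auto
    have "of_int (u (l2 * l3)) * (l2 * l3) + of_int (u (l1 * l3)) * (l1 * l3) + of_int (u (l1 * l2)) * (l1 * l2) = 0"
      using sum ne by (simp add: add.assoc)
    from indep[OF this] u show False by auto
  qed
  with ne show ?thesis unfolding int_basis_def by simp
qed

lemma irrational_conjugate:
  fixes \<sigma> :: "'a :: field_char_0 \<Rightarrow> 'b :: field_char_0"
  assumes "field_hom \<sigma>" "t \<notin> \<rat>"
  shows "\<sigma> t \<notin> \<rat>"
proof
  assume "\<sigma> t \<in> \<rat>"
  then obtain q where "\<sigma> t = of_rat q" by (rule Rats_cases)
  interpret field_hom \<sigma> by fact
  have "\<sigma> (t - of_rat q) = 0"
    using \<open>\<sigma> t = of_rat q\<close> by (simp add: hom_distribs field_hom_of_rat[OF assms(1)])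
  then have "t = of_rat q" by simp
  with assms(2) show False by simp
qed

lemma field_hom_linear_form:
  fixes \<sigma> :: "'a :: field_char_0 \<Rightarrow> 'b :: field_char_0"
  assumes "field_hom \<sigma>"
  shows "\<sigma> (of_int x - of_int y * t) = of_int x - of_int y * \<sigma> t"
proof -
  interpret field_hom \<sigma> by fact
  show ?thesis by (simp add: hom_distribs)
qed

text \<open>Clearing denominators in an equality of the two images would make l and m proportional
  over the rationals. This supplies the distinctness required for the convex hull.\<close>

lemma Q_map_product:
  fixes l m n :: "'a :: number_field"
  assumes mult: "\<And>u v :: 'a. field_norm (u * v) = field_norm u * field_norm v"
    and ne: "l \<noteq> 0" "m \<noteq> 0" "n \<noteq> 0"
    and prop12: "\<And>u v. of_rat u * l = of_rat v * m \<Longrightarrow> u = 0 \<and> v = 0"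
    and nz: "field_norm m \<noteq> 0" "field_norm n \<noteq> 0"
  shows "Q_map (m * n) \<noteq> Q_map (l * n)"
proof
  assume "Q_map (m * n) = Q_map (l * n)"
  then have "of_rat (field_norm m * field_norm n) * l = of_rat (field_norm l * field_norm n) * m"
    using ne by (simp add: Q_map_def mult divide_eq_eq eq_divide_eq)
  then show False using prop12 nz by fastforce
qed

theorem proposition9p2:
  assumes "field_degree TYPE('a :: number_field) = 3"
    and "totally_real TYPE('a)"
  shows "\<exists>(I :: 'a set) r1 r2 r3. fractional_ideal I \<and> admissible_basis (r1, r2, r3) I"
proof -
  obtain t :: 'a and a b c d :: int where a: "a \<noteq> 0" and t: "t \<notin> \<rat>"
    and cubic: "of_int a * t ^ 3 = - of_int b * t\<^sup>2 - of_int c * t - of_int d"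
    and integers: "\<And>y. algebraic_int y \<longleftrightarrow>
        (\<exists>i j k. y = of_int i + of_int j * (of_int a * t) + of_int k * (of_int a * t\<^sup>2 + of_int b * t))"
    using ex_delone_faddeev_generator[OF assms] by (elim exE conjE) metis
  have "t ^ 3 = of_int a * t ^ 3 / of_int a" using a by simp
  also have "\<dots> = of_rat (- of_int d / of_int a) + of_rat (- of_int c / of_int a) * t
      + of_rat (- of_int b / of_int a) * t\<^sup>2"
    unfolding cubic by (simp add: of_rat_divide of_rat_minus diff_divide_distrib)
  finally have t3: "t ^ 3 = of_rat (- of_int d / of_int a) + of_rat (- of_int c / of_int a) * t
      + of_rat (- of_int b / of_int a) * t\<^sup>2" .
  have gen: "cubic_generator t" by (rule cubic_generator_if_irrational[OF assms(1) t])
  obtain \<sigma>1 \<sigma>2 \<sigma>3 :: "'a \<Rightarrow> real" where hom: "field_hom \<sigma>1" "field_hom \<sigma>2" "field_hom \<sigma>3"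
    and ne: "\<sigma>1 t \<noteq> \<sigma>2 t" "\<sigma>2 t \<noteq> \<sigma>3 t" "\<sigma>1 t \<noteq> \<sigma>3 t"
    using ex_real_embeddings[OF gen assms(2) t3] by blast
  note norm = field_norm_eq_prod_embeddings[OF assms(1) hom ne]
  have norm_mult: "field_norm (u * v) = field_norm u * field_norm v" for u v :: 'a
  proof -
    interpret h1: field_hom \<sigma>1 by fact
    interpret h2: field_hom \<sigma>2 by fact
    interpret h3: field_hom \<sigma>3 by fact
    have "real_of_rat (field_norm (u * v)) = real_of_rat (field_norm u * field_norm v)"
      unfolding of_rat_mult norm h1.hom_mult h2.hom_mult h3.hom_mult by (simp only: mult_ac)
    then show ?thesis unfolding of_rat_eq_iff .
  qed
  have norm_form: "of_rat (field_norm (of_int x - of_int y * t)) = cubic_form (\<sigma>1 t) (\<sigma>2 t) (\<sigma>3 t) x y" for x y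
    unfolding norm cubic_form_def using hom by (simp add: field_hom_linear_form)
  obtain x y x' y' :: int where det: "x' * y - x * y' = 1"
    and sign: "0 < cubic_form (\<sigma>1 t) (\<sigma>2 t) (\<sigma>3 t) x y * cubic_form (\<sigma>1 t) (\<sigma>2 t) (\<sigma>3 t) x' y'"
      "cubic_form (\<sigma>1 t) (\<sigma>2 t) (\<sigma>3 t) x y * cubic_form (\<sigma>1 t) (\<sigma>2 t) (\<sigma>3 t) (x + x') (y + y') < 0"
    using separating_superbasis[OF hom[THEN irrational_conjugate, OF t] ne] by blast
  define l1 l2 l3 where "l1 = of_int x - of_int y * t" and "l2 = of_int x' - of_int y' * t"
    and "l3 = - (l1 + l2)"
  have l3: "l3 = of_int (- (x + x')) - of_int (- (y + y')) * t"
    by (simp add: l1_def l2_def l3_def algebra_simps)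
  define n1 n2 n3 where "n1 = field_norm l1" and "n2 = field_norm l2" and "n3 = field_norm l3"
  \<comment> \<open>The odd degree of the form turns the negative sign at the sum of the two vectors
    into the statement that \<open>n3\<close> has the sign of \<open>n1\<close>.\<close>
  have "real_of_rat n3 = - cubic_form (\<sigma>1 t) (\<sigma>2 t) (\<sigma>3 t) (x + x') (y + y')"
    unfolding n3_def l3 norm_form cubic_form_minus ..
  then have "0 < real_of_rat (n1 * n2)" "0 < real_of_rat (n1 * n3)"
    using sign unfolding of_rat_mult n1_def n2_def l1_def l2_def norm_form by simp_all
  then have pos: "0 < n1 * n2" "0 < n1 * n3" unfolding zero_less_of_rat_iff .
  then have pos': "0 < n2 * n3" by (auto simp: zero_less_mult_iff)
  have nz: "n1 \<noteq> 0" "n2 \<noteq> 0" "n3 \<noteq> 0" using pos by auto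
  have prop12: "u = 0 \<and> v = 0" if "of_rat u * l1 = of_rat v * l2" for u v
  proof (rule linear_forms_not_proportional[OF t])
    show "x' * y - x * y' \<noteq> 0" unfolding det by simp
    show "of_rat u * (of_int x - of_int y * t) = of_rat v * (of_int x' - of_int y' * t)"
      using that unfolding l1_def l2_def .
  qed
  have prop13: "u = 0 \<and> v = 0" if "of_rat u * l1 = of_rat v * l3" for u v
  proof (rule linear_forms_not_proportional[OF t])
    have "- (x + x') * y - x * - (y + y') = - (x' * y - x * y')" by (simp add: algebra_simps)
    then show "- (x + x') * y - x * - (y + y') \<noteq> 0" unfolding det by simp
    show "of_rat u * (of_int x - of_int y * t) = of_rat v * (of_int (- (x + x')) - of_int (- (y + y')) * t)"
      using that unfolding l3 l1_def .
  qed
  have prop23: "u = 0 \<and> v = 0" if "of_rat u * l2 = of_rat v * l3" for u v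
  proof (rule linear_forms_not_proportional[OF t])
    have "- (x + x') * y' - x' * - (y + y') = x' * y - x * y'" by (simp add: algebra_simps)
    then show "- (x + x') * y' - x' * - (y + y') \<noteq> 0" unfolding det by simp
    show "of_rat u * (of_int x' - of_int y' * t) = of_rat v * (of_int (- (x + x')) - of_int (- (y + y')) * t)"
      using that unfolding l3 l2_def .
  qed
  have l_nz: "l1 \<noteq> 0" "l2 \<noteq> 0" "l3 \<noteq> 0"
    using prop12[of 1 0] prop12[of 0 1] prop13[of 0 1] by auto
  let ?I = "int_mod.span {l2 * l3, l1 * l3, l1 * l2}"
  have "?I = int_mod.span {1, t, t\<^sup>2}"
    unfolding l3_def l1_def l2_def by (rule span_products_unimodular[OF det])
  then have ideal: "fractional_ideal ?I" using fractional_ideal_delone_faddeev[OF a cubic integers] by simp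
  have "l2 / l1 \<notin> \<rat>"
  proof
    assume "l2 / l1 \<in> \<rat>"
    then obtain q where "l2 / l1 = of_rat q" by (rule Rats_cases)
    then have "of_rat q * l1 = of_rat 1 * l2" using l_nz by (simp add: field_simps)
    then show False using prop12[of q 1] by simp
  qed
  then have "cubic_generator (l2 / l1)" by (rule cubic_generator_if_irrational[OF assms(1)])
  then have basis: "int_basis [l2 * l3, l1 * l3, l1 * l2] ?I"
    unfolding l3_def by (rule int_basis_products[OF l_nz(1)])
  have Q: "Q_map (l2 * l3) = of_rat (n2 * n3) / (l2 * l3)" "Q_map (l1 * l3) = of_rat (n1 * n3) / (l1 * l3)"
    "Q_map (l1 * l2) = of_rat (n1 * n2) / (l1 * l2)"
    by (simp_all add: Q_map_def norm_mult n1_def n2_def n3_def)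
  have "no_half_space {Q_map (l2 * l3), Q_map (l1 * l3), Q_map (l1 * l2)}"
  proof (rule no_half_space_if_positive_relation)
    \<comment> \<open>These weights cancel the norms contained in \<open>Q_map\<close> and leave (l1
      + l2 + l3) / (l1 l2 l3) = 0. They are positive because the three norms have the same
      sign.\<close>
    show "0 < 1 / (n2 * n3)" "0 < 1 / (n1 * n3)" "0 < 1 / (n1 * n2)" using pos pos' by simp_all
    have "of_rat (1 / (n2 * n3)) * Q_map (l2 * l3) + of_rat (1 / (n1 * n3)) * Q_map (l1 * l3)
        + of_rat (1 / (n1 * n2)) * Q_map (l1 * l2) = 1 / (l2 * l3) + 1 / (l1 * l3) + 1 / (l1 * l2)"
      unfolding Q using nz by (simp add: of_rat_divide)
    also have "\<dots> = (l1 + l2 + l3) / (l1 * l2 * l3)" using l_nz by (simp add: field_simps)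
    also have "\<dots> = 0" by (simp add: l3_def)
    finally show "of_rat (1 / (n2 * n3)) * Q_map (l2 * l3) + of_rat (1 / (n1 * n3)) * Q_map (l1 * l3)
        + of_rat (1 / (n1 * n2)) * Q_map (l1 * l2) = 0" .
    \<comment> \<open>Each pair of products shares one factor. It is written last to fit
      \<open>Q_map_product\<close>, hence the reversed products below.\<close>
    have "Q_map (l2 * l3) \<noteq> Q_map (l1 * l3)"
      by (rule Q_map_product[OF norm_mult l_nz prop12]) (use nz in \<open>simp_all add: n1_def n2_def n3_def\<close>)
    moreover have "Q_map (l3 * l2) \<noteq> Q_map (l1 * l2)"
      by (rule Q_map_product[OF norm_mult l_nz(1,3,2) prop13]) (use nz in \<open>simp_all add: n1_def n2_def n3_def\<close>)
    moreover have "Q_map (l3 * l1) \<noteq> Q_map (l2 * l1)"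
      by (rule Q_map_product[OF norm_mult l_nz(2,3,1) prop23]) (use nz in \<open>simp_all add: n1_def n2_def n3_def\<close>)
    ultimately show "distinct [Q_map (l2 * l3), Q_map (l1 * l3), Q_map (l1 * l2)]"
      by (simp add: mult.commute)
  qed
  with basis have "admissible_basis (l2 * l3, l1 * l3, l1 * l2) ?I"
    by (simp add: admissible_basis_def)
  with ideal show ?thesis by blast
qed

end
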